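(* Consider the homogeneous anisotropic Gaussian mixture model with centers $\theta_1^*,\dots,\theta_k^*\in\mathbb{R}^d$ and common positive definite covariance $\Sigma^*$ (arbitrary and held fixed in the supremum below), and let $$\mathsf{SNR}=\min_{a,b\in[k]:a\neq b}\|(\theta_a^*-\theta_b^* )^T(\Sigma^* )^{-1/2}\|.$$ If $\mathsf{SNR}/\sqrt{\log k}\to\infty$, then $$\inf_{\hat z}\ \sup_{z^*\in[k]^n}\ \mathbb{E}\,h(\hat z,z^* )\ \ge\ \exp\left(-(1+o(1))\frac{\mathsf{SNR}^2}{8}\right).$$ If instead $\mathsf{SNR}=O(1)$, then $\inf_{\hat z}\sup_{z^*\in[k]^n}\mathbb{E}\,h(\hat z,z^* )\ge c$ for some constant $c>0$.
   Context: Notation: $[m]=\{1,\dots,m\}$. Model: for $z^*\in[k]^n$, one observes $Y=(Y_1,\dots,Y_n)$ with $Y_j=\theta^*_{z_j^*}+\epsilon_j$, where $\epsilon_1,\dots,\epsilon_n$ are independent and $\epsilon_j\sim\mathcal N(0,\Sigma^* )$ in $\mathbb{R}^d$. Here $k\ge2$ is the number of clusters. The infimum is over all estimators $\hat z=\hat z(Y)\in[k]^n$ (measurable functions of $Y$), and $\mathbb E$ is expectation under the model with label vector $z^*$. Loss: $h(z,z^* )=\min_{\psi}\frac1n\sum_{j=1}^n\mathbb{I}\{\psi(z_j)\ne z_j^*\}$, the minimum being over all bijections $\psi:[k]\to[k]$. Asymptotic convention: $n\to\infty$; $k$, $d$, the centers and the covariance may depend on $n$; $O$, $o$ and limits refer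 to $n\to\infty$; constants do not depend on $n$; conclusions are for all sufficiently large $n$; $o(1)$ in an exponent denotes some deterministic sequence tending to $0$. *)

theory Defs
  imports
    "HOL-Probability.Probability"
    "HOL-Library.Landau_Symbols"
    "Jordan_Normal_Form.Determinant"
    "Jordan_Normal_Form.Gauss_Jordan_Elimination"
begin

(* The dimension d varies with the sample size, so centers and covariance matrices are the
   dynamically sized vectors and matrices of Jordan_Normal_Form (indices start at 0).  Random
   points of R^d are elements of the product space PiM {..<d} borel, so that the product
   sigma-algebra and the Lebesgue measure are available; Matrix.vec d converts them to vectors. *)

no_notation Finite_Cartesian_Product.vec_nth (infixl \<open>$\<close> 90)
no_notation Inner_Product.real_inner_class.inner (infix \<open>\<bullet>\<close> 70)

definition vec_norm2 :: "real Matrix.vec \<Rightarrow> real" where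
  "vec_norm2 v = sqrt (v \<bullet> v)"

definition pos_def_mat :: "nat \<Rightarrow> real Matrix.mat \<Rightarrow> bool" where
  "pos_def_mat d A \<longleftrightarrow> A \<in> carrier_mat d d \<and> transpose_mat A = A \<and>
     (\<forall>v \<in> carrier_vec d. v \<noteq> 0\<^sub>v d \<longrightarrow> 0 < v \<bullet> (A *\<^sub>v v))"

definition inv_mat :: "real Matrix.mat \<Rightarrow> real Matrix.mat" where
  "inv_mat A = the (mat_inverse A)"

(* A^(-1/2): the unique positive definite square root of the inverse of a positive definite A *)
definition inv_sqrt_mat :: "real Matrix.mat \<Rightarrow> real Matrix.mat" where
  "inv_sqrt_mat A = (THE S. pos_def_mat (dim_row A) S \<and> S * S = inv_mat A)"

(* The transpose is written because the paper multiplies the row vector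
   (theta_a - theta_b)^T by A^(-1/2) from the right. *)
definition snr :: "nat \<Rightarrow> (nat \<Rightarrow> real Matrix.vec) \<Rightarrow> real Matrix.mat \<Rightarrow> real" where
  "snr k \<theta> \<Sigma> =
     Min {vec_norm2 (transpose_mat (inv_sqrt_mat \<Sigma>) *\<^sub>v (\<theta> a - \<theta> b)) | a b.
            a \<in> {1..k} \<and> b \<in> {1..k} \<and> a \<noteq> b}"

definition points :: "nat \<Rightarrow> (nat \<Rightarrow> real) measure" where
  "points d = (\<Pi>\<^sub>M i\<in>{..<d}. borel)"

definition gauss_density :: "nat \<Rightarrow> real Matrix.mat \<Rightarrow> (nat \<Rightarrow> real) \<Rightarrow> real" where
  "gauss_density d \<Sigma> x =
     exp (- (Matrix.vec d x \<bullet> (inv_mat \<Sigma> *\<^sub>v Matrix.vec d x)) / 2)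
       / sqrt ((2 * pi) ^ d * Determinant.det \<Sigma>)"

(* N(0, \<Sigma>) *)
definition gauss_law :: "nat \<Rightarrow> real Matrix.mat \<Rightarrow> (nat \<Rightarrow> real) measure" where
  "gauss_law d \<Sigma> = density (\<Pi>\<^sub>M i\<in>{..<d}. lborel) (\<lambda>x. ennreal (gauss_density d \<Sigma> x))"

(* joint law of the independent errors epsilon_1, ..., epsilon_n *)
definition noise_law :: "nat \<Rightarrow> nat \<Rightarrow> real Matrix.mat \<Rightarrow> (nat \<Rightarrow> nat \<Rightarrow> real) measure" where
  "noise_law n d \<Sigma> = (\<Pi>\<^sub>M j\<in>{1..n}. gauss_law d \<Sigma>)"

definition labels :: "nat \<Rightarrow> nat \<Rightarrow> (nat \<Rightarrow> nat) set" where
  "labels n k = {1..n} \<rightarrow>\<^sub>E {1..k}"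

(* the sample Y as a function of the errors: Y_j = theta_(z_j) + epsilon_j *)
definition observation ::
    "nat \<Rightarrow> nat \<Rightarrow> (nat \<Rightarrow> real Matrix.vec) \<Rightarrow> (nat \<Rightarrow> nat) \<Rightarrow> (nat \<Rightarrow> nat \<Rightarrow> real) \<Rightarrow> nat \<Rightarrow> nat \<Rightarrow> real" where
  "observation n d \<theta> z \<epsilon> = (\<lambda>j\<in>{1..n}. \<lambda>i\<in>{..<d}. \<theta> (z j) $ i + \<epsilon> j i)"

definition estimators :: "nat \<Rightarrow> nat \<Rightarrow> nat \<Rightarrow> ((nat \<Rightarrow> nat \<Rightarrow> real) \<Rightarrow> nat \<Rightarrow> nat) set" where
  "estimators n k d = measurable (\<Pi>\<^sub>M j\<in>{1..n}. points d) (count_space (labels n k))"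

definition loss :: "nat \<Rightarrow> nat \<Rightarrow> (nat \<Rightarrow> nat) \<Rightarrow> (nat \<Rightarrow> nat) \<Rightarrow> real" where
  "loss n k z z' =
     Min ((\<lambda>\<psi>. (1 / real n) * (\<Sum>j = 1..n. of_bool (\<psi> (z j) \<noteq> z' j))) ` {\<psi>. \<psi> permutes {1..k}})"

definition risk ::
    "nat \<Rightarrow> nat \<Rightarrow> nat \<Rightarrow> (nat \<Rightarrow> real Matrix.vec) \<Rightarrow> real Matrix.mat \<Rightarrow>
     ((nat \<Rightarrow> nat \<Rightarrow> real) \<Rightarrow> nat \<Rightarrow> nat) \<Rightarrow> (nat \<Rightarrow> nat) \<Rightarrow> real" where
  "risk n k d \<theta> \<Sigma> zhat z =
     (\<integral>\<epsilon>. loss n k (zhat (observation n d \<theta> z \<epsilon>)) z \<partial>noise_law n d \<Sigma>)"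

definition minimax_risk ::
    "nat \<Rightarrow> nat \<Rightarrow> nat \<Rightarrow> (nat \<Rightarrow> real Matrix.vec) \<Rightarrow> real Matrix.mat \<Rightarrow> real" where
  "minimax_risk n k d \<theta> \<Sigma> =
     (INF zhat \<in> estimators n k d. SUP z \<in> labels n k. risk n k d \<theta> \<Sigma> zhat z)"

end

theory Submission
  imports
    Defs
    "HOL-Real_Asymp.Real_Asymp"
    "Jordan_Normal_Form.Spectral_Radius"
begin

text \<open>Let \<open>a\<close>, \<open>b\<close> be two clusters whose centers attain the minimum \<open>D\<close> defining the SNR. A third of the
  labels range freely over \<open>{a, b}\<close>, while known blocks of labels \<open>a\<close> and \<open>b\<close> make the minimum over
  permutations in the loss harmless. Averaging over the free labels and pairing each label vector with the
  one that differs only at \<open>j\<close> bounds the risk below by the total error of testing \<open>N(\<theta>\<^sub>a, \<Sigma>)\<close> against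
  \<open>N(\<theta>\<^sub>b, \<Sigma>)\<close>, up to a constant. With both densities recentred at the midpoint of the centers, their
  minimum is \<open>exp (- D\<^sup>2 / 8) * exp (- \<bar>l\<bar>)\<close> times the centred Gaussian density, where \<open>l\<close> is a
  linear form of standard deviation \<open>D / 2\<close>. Hence the risk is at least
  \<open>exp (- D\<^sup>2 / 8 - D - 1) / 40\<close> whenever \<open>n \<ge> 3\<close>, for all \<open>k\<close> and \<open>d\<close>; both claims follow.\<close>

section \<open>Square roots of positive definite matrices\<close>

text \<open>The error of the two-point test is a Gaussian tail along the direction separating the
  centers. Bounding the overlap through \<open>exp (- \<bar>l\<bar>)\<close> avoids both the
  projection onto that direction and tail estimates: translations of Lebesgue measure already yield
  the exponential moments of \<open>l\<close>, in any dimension. The price is a factor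
  \<open>exp (- D - 1)\<close>, harmless because D is o(D^2) when D tends to infinity and bounded
  when D is bounded; so one finite-sample bound serves both regimes. The factor 40 collects 2 from
  the Chernoff step, 2 from projecting the estimate onto the family, 2 from averaging over a pair of
  label vectors and 5 from the share of free labels. The matrix theory is forced by the definite
  description behind \<Sigma>^(-1/2): existence and uniqueness of the root must be known before the
  squared SNR can be identified with a value of the quadratic form of the inverse
  covariance.\<close>

lemma symmetric_scalar_prod:
  assumes A: "A \<in> carrier_mat n n" and "transpose_mat A = A"
    and "x \<in> carrier_vec n" "y \<in> carrier_vec n"
  shows "x \<bullet> (A *\<^sub>v y) = (A *\<^sub>v x) \<bullet> (y :: real Matrix.vec)"
  using transpose_vec_mult_scalar[OF A assms(4,3)] assms by simp

lemma scalar_prod_self_pos: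
  assumes "v \<in> carrier_vec n" "v \<noteq> 0\<^sub>v n"
  shows "0 < v \<bullet> (v :: real Matrix.vec)"
proof -
  obtain i where i: "i < n" "v $ i \<noteq> 0"
    using assms by (metis carrier_vecD eq_vecI index_zero_vec(1,2))
  have "v \<bullet> v = (\<Sum>i<n. v $ i * v $ i)"
    using assms by (simp add: scalar_prod_def atLeast0LessThan)
  also have "\<dots> > 0"
    using i by (intro sum_pos2[of _ i]) (auto simp: zero_less_mult_iff linorder_neq_iff)
  finally show ?thesis .
qed

text \<open>Positivity forces a trivial kernel, so the determinant is nonzero and Gauss-Jordan
  elimination succeeds. The inverse inherits positivity through v = A w. The determinant identity
  serves the normalising constant of the density.\<close>

lemma pos_def_mat_inv_mat:
  assumes "pos_def_mat n A"
  shows "A * inv_mat A = 1\<^sub>m n" "inv_mat A * A = 1\<^sub>m n" "pos_def_mat n (inv_mat A)"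
    "Determinant.det A * Determinant.det (inv_mat A) = 1"
proof -
  from assms have A: "A \<in> carrier_mat n n" and sym: "transpose_mat A = A"
    and pos: "\<And>v. v \<in> carrier_vec n \<Longrightarrow> v \<noteq> 0\<^sub>v n \<Longrightarrow> 0 < v \<bullet> (A *\<^sub>v v)"
    unfolding pos_def_mat_def by auto
  have "Determinant.det A \<noteq> 0"
    using det_0_iff_vec_prod_zero[OF A] pos by fastforce
  then have "A \<in> Units (ring_mat TYPE(real) n ())"
    by (rule det_non_zero_imp_unit[OF A])
  then have inv: "mat_inverse A = Some (inv_mat A)"
    using mat_inverse(1)[OF A, where b = "()"] unfolding inv_mat_def by (cases "mat_inverse A") auto
  let ?B = "inv_mat A"
  from mat_inverse(2)[OF A inv]
  show AB: "A * ?B = 1\<^sub>m n" and BA: "?B * A = 1\<^sub>m n" by auto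
  from mat_inverse(2)[OF A inv] have B: "?B \<in> carrier_mat n n" by auto
  show "Determinant.det A * Determinant.det ?B = 1"
    using det_mult[OF A B] AB by simp
  have "transpose_mat ?B = transpose_mat ?B * (A * ?B)"
    using AB B by simp
  also have "\<dots> = transpose_mat ?B * transpose_mat A * ?B"
    using A B sym by (simp add: assoc_mult_mat[of _ n n _ n _ n])
  also have "transpose_mat ?B * transpose_mat A = 1\<^sub>m n"
    using transpose_mult[OF A B] AB by simp
  finally have symB: "transpose_mat ?B = ?B" using B by simp
  have "0 < v \<bullet> (?B *\<^sub>v v)" if v: "v \<in> carrier_vec n" "v \<noteq> 0\<^sub>v n" for v
  proof -
    define w where "w = ?B *\<^sub>v v"
    have w: "w \<in> carrier_vec n" using B v by (auto simp: w_def)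
    have Aw: "A *\<^sub>v w = v"
      unfolding w_def using A B v AB by (simp add: assoc_mult_mat_vec[symmetric])
    have "w \<noteq> 0\<^sub>v n" using Aw v A by auto
    then have "0 < w \<bullet> (A *\<^sub>v w)" using pos w by blast
    then show ?thesis
      using Aw w v comm_scalar_prod w_def by metis
  qed
  then show "pos_def_mat n ?B" unfolding pos_def_mat_def using B symB by auto
qed

section \<open>Real eigenvectors and reflections\<close>

text \<open>A complex eigenvector x + i y exists because the spectrum is nonempty. Symmetry of A,
  applied to the pair x, y, forces Im \<mu> (|x|^2 + |y|^2) = 0, so \<mu> is real and whichever of
  x, y is nonzero is a real eigenvector.\<close>

lemma symmetric_real_eigenvector:
  fixes A :: "real Matrix.mat"
  assumes A: "A \<in> carrier_mat n n" and sym: "transpose_mat A = A" and n: "0 < n"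
  obtains v a where "v \<in> carrier_vec n" "v \<noteq> 0\<^sub>v n" "A *\<^sub>v v = a \<cdot>\<^sub>v v"
proof -
  define C where "C = map_mat complex_of_real A"
  have C: "C \<in> carrier_mat n n" using A by (simp add: C_def)
  obtain \<mu> w where w: "w \<in> carrier_vec n" "w \<noteq> 0\<^sub>v n" "C *\<^sub>v w = \<mu> \<cdot>\<^sub>v w"
    using spectrum_non_empty[OF C n] C
    unfolding spectrum_def eigenvalue_def eigenvector_def by fastforce
  define x where "x = map_vec Re w"
  define y where "y = map_vec Im w"
  have x: "x \<in> carrier_vec n" and y: "y \<in> carrier_vec n"
    using w by (auto simp: x_def y_def)
  have entry: "(\<Sum>j = 0..<n. complex_of_real (A $$ (i, j)) * w $ j) = \<mu> * w $ i" if "i < n" for i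
    using arg_cong[OF w(3), of "\<lambda>u. u $ i"] that C A w(1) by (simp add: scalar_prod_def C_def)
  have Ax: "A *\<^sub>v x = Re \<mu> \<cdot>\<^sub>v x - Im \<mu> \<cdot>\<^sub>v y"
  proof (rule eq_vecI)
    fix i assume "i < dim_vec (Re \<mu> \<cdot>\<^sub>v x - Im \<mu> \<cdot>\<^sub>v y)"
    then have i: "i < n" using y by auto
    show "(A *\<^sub>v x) $ i = (Re \<mu> \<cdot>\<^sub>v x - Im \<mu> \<cdot>\<^sub>v y) $ i"
      using arg_cong[OF entry[OF i], of Re] i A w(1) by (simp add: scalar_prod_def x_def y_def)
  qed (use A y in auto)
  have Ay: "A *\<^sub>v y = Im \<mu> \<cdot>\<^sub>v x + Re \<mu> \<cdot>\<^sub>v y"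
  proof (rule eq_vecI)
    fix i assume "i < dim_vec (Im \<mu> \<cdot>\<^sub>v x + Re \<mu> \<cdot>\<^sub>v y)"
    then have i: "i < n" using y by auto
    show "(A *\<^sub>v y) $ i = (Im \<mu> \<cdot>\<^sub>v x + Re \<mu> \<cdot>\<^sub>v y) $ i"
      using arg_cong[OF entry[OF i], of Im] i A w(1) by (simp add: scalar_prod_def x_def y_def)
  qed (use A y in auto)
  have "x \<bullet> (A *\<^sub>v y) = (A *\<^sub>v x) \<bullet> y"
    by (rule symmetric_scalar_prod[OF A sym x y])
  then have "Im \<mu> * (x \<bullet> x + y \<bullet> y) = 0"
    using x y
    by (simp add: Ax Ay scalar_prod_add_distrib[of _ n] minus_scalar_prod_distrib[of _ n] algebra_simps)
  moreover have nz: "x \<noteq> 0\<^sub>v n \<or> y \<noteq> 0\<^sub>v n"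
  proof (rule ccontr)
    assume *: "\<not> (x \<noteq> 0\<^sub>v n \<or> y \<noteq> 0\<^sub>v n)"
    then have "w $ i = 0" if "i < n" for i
      using that w(1) * by (metis carrier_vecD complex_eq_iff index_map_vec(1)
          index_zero_vec(1) x_def y_def zero_complex.sel)
    then show False using w by auto
  qed
  moreover have "x \<bullet> x + y \<bullet> y \<noteq> 0"
    using nz scalar_prod_self_pos[OF x] scalar_prod_self_pos[OF y] x y
    by (cases "x = 0\<^sub>v n"; cases "y = 0\<^sub>v n") auto
  ultimately have "Im \<mu> = 0" by simp
  then have "A *\<^sub>v x = Re \<mu> \<cdot>\<^sub>v x" "A *\<^sub>v y = Re \<mu> \<cdot>\<^sub>v y"
    using x y by (auto simp: Ax Ay)
  then show ?thesis using nz x y that by blast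
qed

text \<open>The matrix is the Householder reflection in the hyperplane orthogonal to \<open>u - e\<^sub>0\<close>,
  where \<open>u\<close> is \<open>v\<close> normalised; for \<open>u = e\<^sub>0\<close> the convention \<open>2 / 0 = 0\<close> makes it the identity.\<close>

lemma reflection_to_direction:
  fixes v :: "real Matrix.vec"
  assumes v: "v \<in> carrier_vec n" "v \<noteq> 0\<^sub>v n" and n: "0 < n"
  obtains H c where "H \<in> carrier_mat n n" "transpose_mat H = H" "H * H = 1\<^sub>m n"
    "Matrix.col H 0 = c \<cdot>\<^sub>v v"
proof -
  define r where "r = sqrt (v \<bullet> v)"
  have r: "r > 0" "r * r = v \<bullet> v" using scalar_prod_self_pos[OF v] by (auto simp: r_def)
  define w where "w = (1 / r) \<cdot>\<^sub>v v - unit_vec n 0"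
  have w: "w \<in> carrier_vec n" using v by (simp add: w_def)
  define q where "q = (\<Sum>i<n. w $ i * w $ i)"
  define s where "s = 2 / q"
  \<comment> \<open>For \<open>q = 0\<close> the left side is 0, so the identity survives for every
    x that vanishes along with q; below, x is always a multiple of an entry of w.\<close>
  have sq: "s * q * x = 2 * x" if "q = 0 \<Longrightarrow> x = 0" for x
    using that by (auto simp: s_def)
  have q0: "w $ i = 0" if "q = 0" "i < n" for i
    using that unfolding q_def by (subst (asm) sum_nonneg_eq_0_iff) auto
  \<comment> \<open>With the unit vector u = v / r this is |u - e_0|^2 = 2 - 2 u_0 = -2 w_0, the
    relation that makes column 0 of the reflection equal to u.\<close>
  have "q = w \<bullet> w" using w by (simp add: q_def scalar_prod_def atLeast0LessThan)
  also have "\<dots> = (v \<bullet> v / r - v $ 0) / r - v $ 0 / r + 1"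
    unfolding w_def using v n
    by (simp add: minus_scalar_prod_distrib[of _ n] scalar_prod_minus_distrib[of _ n])
  also have "\<dots> = - 2 * w $ 0"
    using r(1) r(2)[symmetric] v n by (simp add: w_def field_simps)
  finally have q2: "q = - 2 * w $ 0" .
  define H where "H = Matrix.mat n n (\<lambda>(i, j). of_bool (i = j) - s * w $ i * w $ j)"
  have H: "H \<in> carrier_mat n n" by (simp add: H_def)
  have "transpose_mat H = H" by (rule eq_matI) (auto simp: H_def)
  moreover have "H * H = 1\<^sub>m n"
  proof (rule eq_matI)
    fix i j assume "i < dim_row (1\<^sub>m n)" "j < dim_col (1\<^sub>m n)"
    then have ij: "i < n" "j < n" by auto
    have delta: "(\<Sum>l<n. of_bool (i = l) * g l) = g i" "(\<Sum>l<n. of_bool (l = j) * g l) = g j"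
      for g :: "nat \<Rightarrow> real"
    proof -
      have "(\<Sum>l<n. of_bool (i = l) * g l) = (\<Sum>l<n. if i = l then g l else 0)"
        "(\<Sum>l<n. of_bool (l = j) * g l) = (\<Sum>l<n. if l = j then g l else 0)"
        by (auto intro!: sum.cong)
      then show "(\<Sum>l<n. of_bool (i = l) * g l) = g i" "(\<Sum>l<n. of_bool (l = j) * g l) = g j"
        using ij by simp_all
    qed
    have "(H * H) $$ (i, j) = (\<Sum>l<n. (of_bool (i = l) - s * w $ i * w $ l) * (of_bool (l = j) - s * w $ l * w $ j))"
      using ij by (simp add: H_def scalar_prod_def atLeast0LessThan)
    also have "\<dots> = (\<Sum>l<n. of_bool (i = l) * of_bool (l = j) - (of_bool (i = l) * (s * w $ l * w $ j)
        + of_bool (l = j) * (s * w $ i * w $ l)) + s * s * w $ i * w $ j * (w $ l * w $ l))"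
      by (intro sum.cong) (auto simp: algebra_simps)
    also have "\<dots> = of_bool (i = j) - (s * w $ i * w $ j + s * w $ i * w $ j) + s * s * w $ i * w $ j * q"
      using ij by (simp only: sum.distrib sum_subtractf delta q_def sum_distrib_left[symmetric])
    also have "s * s * w $ i * w $ j * q = 2 * (s * w $ i * w $ j)"
      using sq[of "s * w $ i * w $ j"] q0[of i] ij by (simp add: algebra_simps)
    finally show "(H * H) $$ (i, j) = 1\<^sub>m n $$ (i, j)" using ij by simp
  qed (use H in auto)
  moreover have "Matrix.col H 0 = (1 / r) \<cdot>\<^sub>v v"
  proof (rule eq_vecI)
    fix i assume "i < dim_vec ((1 / r) \<cdot>\<^sub>v v)"
    then have i: "i < n" using v by simp
    have "s * w $ 0 * w $ i = - w $ i"
      using sq[of "w $ i"] q0[of i] i q2 by (simp add: algebra_simps)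
    moreover have "Matrix.col H 0 $ i = of_bool (i = 0) - s * w $ 0 * w $ i"
      using i n by (simp add: H_def)
    moreover have "w $ i = v $ i / r - of_bool (i = 0)"
      using i n v by (simp add: w_def)
    ultimately show "Matrix.col H 0 $ i = ((1 / r) \<cdot>\<^sub>v v) $ i"
      using i v by simp
  qed (use H v in auto)
  ultimately show ?thesis using that H by blast
qed

text \<open>H is its own inverse, so H v is nonzero whenever v is, and symmetry moves the left
  factor H onto v.\<close>

lemma pos_def_mat_conj:
  assumes A: "pos_def_mat n A" and H: "H \<in> carrier_mat n n" "transpose_mat H = H" "H * H = 1\<^sub>m n"
  shows "pos_def_mat n (H * A * H)"
proof -
  from A have A: "A \<in> carrier_mat n n" and sym: "transpose_mat A = A"
    and pos: "\<And>v. v \<in> carrier_vec n \<Longrightarrow> v \<noteq> 0\<^sub>v n \<Longrightarrow> 0 < v \<bullet> (A *\<^sub>v v)"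
    unfolding pos_def_mat_def by auto
  have "transpose_mat (H * A * H) = H * A * H"
    using A H sym by (simp add: transpose_mult[of _ n n _ n] assoc_mult_mat[of _ n n _ n _ n])
  moreover have "0 < v \<bullet> ((H * A * H) *\<^sub>v v)" if v: "v \<in> carrier_vec n" "v \<noteq> 0\<^sub>v n" for v
  proof -
    have "H *\<^sub>v (H *\<^sub>v v) = v"
      using H v by (simp add: assoc_mult_mat_vec[symmetric])
    moreover have "H *\<^sub>v 0\<^sub>v n = 0\<^sub>v n" using H(1) by (intro eq_vecI) auto
    ultimately have "H *\<^sub>v v \<noteq> 0\<^sub>v n" using v(2) by metis
    moreover have "v \<bullet> ((H * A * H) *\<^sub>v v) = (H *\<^sub>v v) \<bullet> (A *\<^sub>v (H *\<^sub>v v))"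
      using A H v by (simp add: assoc_mult_mat_vec[of _ n n _ n] symmetric_scalar_prod)
    ultimately show ?thesis using pos[of "H *\<^sub>v v"] H v by auto
  qed
  ultimately show ?thesis unfolding pos_def_mat_def using A H by auto
qed

lemma mult_conj:
  assumes "A \<in> carrier_mat n n" "B \<in> carrier_mat n n" "H \<in> carrier_mat n n" "H * H = 1\<^sub>m n"
  shows "(H * A * H) * (H * B * H) = H * (A * B) * (H :: real Matrix.mat)"
proof -
  have "(H * A * H) * (H * B * H) = H * A * ((H * H) * (B * H))"
    using assms(1-3) by (simp add: assoc_mult_mat[of _ n n _ n _ n])
  then show ?thesis using assms by (simp add: assoc_mult_mat[of _ n n _ n _ n])
qed

section \<open>Square roots by deflation\<close>

text \<open>The direct sum of the scalar p and S. The scalar block comes first because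
  \<open>reflection_to_direction\<close> puts the eigenvector into column 0.\<close>

definition block_diag :: "real \<Rightarrow> real Matrix.mat \<Rightarrow> real Matrix.mat" where
  "block_diag p S = four_block_mat (Matrix.mat 1 1 (\<lambda>_. p)) (0\<^sub>m 1 (dim_row S)) (0\<^sub>m (dim_row S) 1) S"

lemma block_diag_quad:
  assumes S: "S \<in> carrier_mat n n" and v: "v \<in> carrier_vec n"
  shows "(Matrix.vec 1 (\<lambda>_. a) @\<^sub>v v) \<bullet> (block_diag p S *\<^sub>v (Matrix.vec 1 (\<lambda>_. a) @\<^sub>v v))
    = p * a\<^sup>2 + v \<bullet> (S *\<^sub>v v)"
proof -
  have p: "Matrix.mat 1 1 (\<lambda>_. p) *\<^sub>v Matrix.vec 1 (\<lambda>_. a) = Matrix.vec 1 (\<lambda>_. p * a)"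
    by (rule eq_vecI) (simp_all add: scalar_prod_def)
  have "block_diag p S *\<^sub>v (Matrix.vec 1 (\<lambda>_. a) @\<^sub>v v) =
      (Matrix.mat 1 1 (\<lambda>_. p) *\<^sub>v Matrix.vec 1 (\<lambda>_. a)) @\<^sub>v (S *\<^sub>v v)"
    unfolding block_diag_def using S v
    by (subst four_block_mat_mult_vec[of _ 1 1 _ n _ n]) auto
  also have "(Matrix.vec 1 (\<lambda>_. a) @\<^sub>v v) \<bullet> \<dots>
      = Matrix.vec 1 (\<lambda>_. a) \<bullet> Matrix.vec 1 (\<lambda>_. p * a) + v \<bullet> (S *\<^sub>v v)"
    unfolding p by (rule scalar_prod_append[OF vec_carrier v vec_carrier mult_mat_vec_carrier[OF S v]])
  also have "Matrix.vec 1 (\<lambda>_. a) \<bullet> Matrix.vec 1 (\<lambda>_. p * a) = p * a\<^sup>2"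
    by (simp add: scalar_prod_def power2_eq_square)
  finally show ?thesis .
qed

text \<open>Used in both directions: to read off that the eigenvalue and the remaining block are
  positive, and to certify the matrix assembled from their roots.\<close>

lemma pos_def_mat_block_diag_iff:
  assumes S: "S \<in> carrier_mat n n"
  shows "pos_def_mat (Suc n) (block_diag p S) \<longleftrightarrow> 0 < p \<and> pos_def_mat n S"
proof -
  have sym: "transpose_mat (block_diag p S) = block_diag p S \<longleftrightarrow> transpose_mat S = S"
  proof -
    have "transpose_mat (block_diag p S) = block_diag p (transpose_mat S)"
      unfolding block_diag_def using S
      by (subst transpose_four_block_mat[of _ 1 1 _ n _ n]) (auto intro!: arg_cong4[where f = four_block_mat] eq_matI)
    moreover have "block_diag p M = block_diag p S \<longleftrightarrow> M = S" if "M \<in> carrier_mat n n" for M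
    proof
      assume *: "block_diag p M = block_diag p S"
      have "M $$ (i, j) = S $$ (i, j)" if "i < n" "j < n" for i j
        using arg_cong[OF *, of "\<lambda>X. X $$ (Suc i, Suc j)"] that S \<open>M \<in> _\<close> by (simp add: block_diag_def)
      then show "M = S" using S that by (intro eq_matI) auto
    qed simp
    ultimately show ?thesis using S by simp
  qed
  have carr: "block_diag p S \<in> carrier_mat (Suc n) (Suc n)"
    using S by (intro carrier_matI) (simp_all add: block_diag_def)
  show ?thesis
  proof
    assume L: "pos_def_mat (Suc n) (block_diag p S)"
    have pos: "0 < p * a\<^sup>2 + v \<bullet> (S *\<^sub>v v)" if "v \<in> carrier_vec n" "a \<noteq> 0 \<or> v \<noteq> 0\<^sub>v n" for a v
    proof -
      let ?w = "Matrix.vec 1 (\<lambda>_. a) @\<^sub>v v"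
      have "?w \<noteq> 0\<^sub>v (Suc n)"
      proof
        assume *: "?w = 0\<^sub>v (Suc n)"
        have "a = 0" using arg_cong[OF *, of "\<lambda>u. u $ 0"] that(1) by simp
        moreover have "v $ i = 0" if "i < n" for i
          using arg_cong[OF *, of "\<lambda>u. u $ Suc i"] that \<open>v \<in> _\<close> by simp
        ultimately show False using \<open>a \<noteq> 0 \<or> v \<noteq> 0\<^sub>v n\<close> \<open>v \<in> _\<close> by auto
      qed
      moreover have "?w \<in> carrier_vec (Suc n)" using that(1) by (intro carrier_vecI) simp
      ultimately show ?thesis
        using L block_diag_quad[OF S that(1), of a p] unfolding pos_def_mat_def by metis
    qed
    have "0 < p" using pos[of "0\<^sub>v n" 1] S by simp
    then show "0 < p \<and> pos_def_mat n S"
      using L S pos[where a = 0] sym unfolding pos_def_mat_def by auto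
  next
    assume R: "0 < p \<and> pos_def_mat n S"
    have "0 < w \<bullet> (block_diag p S *\<^sub>v w)" if w: "w \<in> carrier_vec (Suc n)" "w \<noteq> 0\<^sub>v (Suc n)" for w
    proof -
      define a where "a = w $ 0"
      define v where "v = Matrix.vec n (\<lambda>i. w $ Suc i)"
      have v: "v \<in> carrier_vec n" by (simp add: v_def)
      have weq: "w = Matrix.vec 1 (\<lambda>_. a) @\<^sub>v v"
        using w by (intro eq_vecI) (auto simp: a_def v_def)
      have "a \<noteq> 0 \<or> v \<noteq> 0\<^sub>v n"
        using w(2) weq by (auto intro!: eq_vecI)
      moreover have "v \<noteq> 0\<^sub>v n \<Longrightarrow> 0 < v \<bullet> (S *\<^sub>v v)" using R v unfolding pos_def_mat_def by blast
      moreover have "v = 0\<^sub>v n \<Longrightarrow> v \<bullet> (S *\<^sub>v v) = 0" using S by simp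
      ultimately have "0 < p * a\<^sup>2 + v \<bullet> (S *\<^sub>v v)"
        using R by (cases "v = 0\<^sub>v n"; cases "a = 0") (auto intro!: add_nonneg_pos add_pos_pos)
      then show ?thesis using block_diag_quad[OF S v] weq by metis
    qed
    then show "pos_def_mat (Suc n) (block_diag p S)"
      using R carr sym unfolding pos_def_mat_def by blast
  qed
qed


lemma mult_block_diag:
  assumes "S \<in> carrier_mat n n" "T \<in> carrier_mat n n"
  shows "block_diag p S * block_diag q T = block_diag (p * q) (S * T)"
  unfolding block_diag_def using assms
  by (subst mult_four_block_mat[of _ 1 1 _ n _ n _ _ 1 _ n])
    (auto intro!: arg_cong4[where f = four_block_mat] eq_matI simp: scalar_prod_def)

text \<open>Induction by deflation: conjugating with a reflection whose column 0 is an eigenvector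
  clears column 0 below the diagonal, symmetry clears row 0, and the root is taken blockwise and
  conjugated back.\<close>

lemma pos_def_mat_sqrt_exists:
  assumes "pos_def_mat n A"
  shows "\<exists>S. pos_def_mat n S \<and> S * S = A"
  using assms
proof (induction n arbitrary: A)
  case 0
  then show ?case by (intro exI[of _ A]) (auto simp: pos_def_mat_def intro!: eq_matI)
next
  case (Suc n)
  let ?n = "Suc n"
  from Suc.prems have A: "A \<in> carrier_mat ?n ?n" "transpose_mat A = A"
    unfolding pos_def_mat_def by auto
  obtain v a where v: "v \<in> carrier_vec ?n" "v \<noteq> 0\<^sub>v ?n" "A *\<^sub>v v = a \<cdot>\<^sub>v v"
    using symmetric_real_eigenvector[OF A] by blast
  obtain H c where H: "H \<in> carrier_mat ?n ?n" "transpose_mat H = H" "H * H = 1\<^sub>m ?n"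
    and col: "Matrix.col H 0 = c \<cdot>\<^sub>v v"
    using reflection_to_direction[OF v(1,2)] by blast
  define B where "B = H * A * H"
  have pB: "pos_def_mat ?n B" unfolding B_def by (rule pos_def_mat_conj[OF Suc.prems H])
  then have B: "B \<in> carrier_mat ?n ?n" "transpose_mat B = B" unfolding pos_def_mat_def by auto
  have "Matrix.col B 0 = (H * A) *\<^sub>v Matrix.col H 0"
    unfolding B_def using A H by (intro col_mult2) auto
  also have "\<dots> = H *\<^sub>v (A *\<^sub>v (c \<cdot>\<^sub>v v))"
    using A H v by (simp add: col)
  also have "A *\<^sub>v (c \<cdot>\<^sub>v v) = a \<cdot>\<^sub>v Matrix.col H 0"
    using A v by (simp add: mult_mat_vec[of _ ?n ?n] col smult_smult_assoc mult.commute)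
  also have "H *\<^sub>v (a \<cdot>\<^sub>v Matrix.col H 0) = a \<cdot>\<^sub>v Matrix.col (H * H) 0"
    using H(1) mult_mat_vec[OF H(1), of "Matrix.col H 0" a] col_mult2[OF H(1) H(1), of 0] by auto
  finally have col0: "Matrix.col B 0 = a \<cdot>\<^sub>v unit_vec ?n 0" using H by simp
  have B0: "B $$ (i, 0) = (if i = 0 then a else 0)" if "i < ?n" for i
    using arg_cong[OF col0, of "\<lambda>u. u $ i"] that B by auto
  have B0': "B $$ (0, i) = (if i = 0 then a else 0)" if "i < ?n" for i
    using B0[OF that] B that by (metis carrier_matD index_transpose_mat(1) zero_less_Suc)
  define C where "C = Matrix.mat n n (\<lambda>(i, j). B $$ (Suc i, Suc j))"
  have C: "C \<in> carrier_mat n n" by (simp add: C_def)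
  have BC: "B = block_diag a C"
    using B C B0 B0' by (intro eq_matI) (auto simp: block_diag_def C_def)
  have "0 < a" "pos_def_mat n C"
    using pB pos_def_mat_block_diag_iff[OF C] by (auto simp: BC)
  then obtain S where S: "pos_def_mat n S" "S * S = C" using Suc.IH by blast
  have Sc: "S \<in> carrier_mat n n" using S unfolding pos_def_mat_def by auto
  define T where "T = block_diag (sqrt a) S"
  have pT: "pos_def_mat ?n T" unfolding T_def using pos_def_mat_block_diag_iff[OF Sc] S \<open>0 < a\<close> by auto
  then have T: "T \<in> carrier_mat ?n ?n" unfolding pos_def_mat_def by auto
  have TT: "T * T = B" using \<open>0 < a\<close> S Sc by (simp add: T_def mult_block_diag BC)
  have "(H * T * H) * (H * T * H) = H * (H * A * H) * H"
    using mult_conj[OF T T H(1,3)] by (simp add: TT B_def)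
  also have "\<dots> = (H * H) * A * (H * H)"
    using A(1) H(1) by (simp add: assoc_mult_mat[of _ ?n ?n _ ?n _ ?n])
  also have "\<dots> = A" using A(1) H(3) by simp
  finally show ?case using pos_def_mat_conj[OF pT H] by blast
qed

text \<open>With \<open>D = S - T\<close> one has \<open>S * D + D * T = 0\<close>, so \<open>D * S * D + D * T * D\<close> has trace \<open>0\<close>;
  its diagonal entries are values of the form of \<open>S + T\<close> at the columns of \<open>D\<close>.\<close>

lemma pos_def_mat_sqrt_unique:
  assumes pS: "pos_def_mat n S" and pT: "pos_def_mat n T" and eq: "S * S = T * T"
  shows "S = T"
proof -
  from pS pT have S: "S \<in> carrier_mat n n" "transpose_mat S = S"
    and T: "T \<in> carrier_mat n n" "transpose_mat T = T"
    unfolding pos_def_mat_def by auto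
  define D where "D = S - T"
  have D: "D \<in> carrier_mat n n" using S T by (auto simp: D_def)
  have symD: "transpose_mat D = D"
    unfolding D_def using S T by (simp add: transpose_minus[of _ n n])
  define q where "q = (\<lambda>M i. Matrix.col D i \<bullet> (M *\<^sub>v Matrix.col D i))"
  have entry: "(D * (M * D)) $$ (i, i) = q M i" if "M \<in> carrier_mat n n" "i < n" for M i
  proof -
    have "Matrix.row D i = Matrix.col D i" using symD that D by (metis carrier_matD(2) row_transpose)
    then show ?thesis
      using that D by (simp add: q_def col_mult2[of _ n n _ n])
  qed
  have "D * (S * D) + D * (D * T) = D * (S * D + D * T)"
    using S T D by (simp add: mult_add_distrib_mat[of _ n n _ n])
  also have "S * D + D * T = 0\<^sub>m n n"
  proof -
    have "S * D = S * S - S * T" "D * T = S * T - T * T"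
      unfolding D_def using S T by (auto simp: mult_minus_distrib_mat[of _ n n _ n] minus_mult_distrib_mat[of _ n n _ _ n])
    then show ?thesis using S T by (auto simp: eq intro!: eq_matI)
  qed
  finally have zero: "D * (S * D) + D * (D * T) = 0\<^sub>m n n" using D by simp
  have "(\<Sum>i<n. q S i) + (\<Sum>i<n. (D * (D * T)) $$ (i, i)) = (\<Sum>i<n. (D * (S * D) + D * (D * T)) $$ (i, i))"
    using S T D by (subst sum.distrib[symmetric], intro sum.cong) (auto simp: entry[symmetric] simp del: index_mult_mat(1))
  also have "\<dots> = 0" unfolding zero by simp
  \<comment> \<open>Cyclicity of the trace turns D D T into D T D, whose diagonal entries are
    \<open>q T i\<close>.\<close>
  also have "(\<Sum>i<n. (D * (D * T)) $$ (i, i)) = (\<Sum>i<n. \<Sum>j<n. D $$ (i, j) * (D * T) $$ (j, i))"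
    using T D by (simp add: scalar_prod_def atLeast0LessThan)
  also have "\<dots> = (\<Sum>j<n. \<Sum>i<n. (D * T) $$ (j, i) * D $$ (i, j))"
    by (subst sum.swap) (simp add: mult.commute)
  also have "\<dots> = (\<Sum>j<n. ((D * T) * D) $$ (j, j))"
    using T D by (simp add: scalar_prod_def atLeast0LessThan del: assoc_mult_mat)
  also have "\<dots> = (\<Sum>j<n. q T j)"
    using T D by (intro sum.cong) (auto simp: entry[symmetric] assoc_mult_mat[of _ n n _ n _ n] simp del: index_mult_mat(1))
  finally have sum0: "(\<Sum>i<n. q S i + q T i) = 0" by (simp add: sum.distrib)
  have col_carr: "Matrix.col D i \<in> carrier_vec n" for i using D by auto
  have pos: "0 < q S i + q T i" if "Matrix.col D i \<noteq> 0\<^sub>v n" for i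
    using pS pT that col_carr unfolding q_def pos_def_mat_def by (simp add: add_pos_pos)
  have nonneg: "0 \<le> q S i + q T i" for i
    using pos[of i] S T by (cases "Matrix.col D i = 0\<^sub>v n") (auto simp: q_def)
  have "q S i + q T i = 0" if "i < n" for i
    using that sum0 sum_nonneg_eq_0_iff[of "{..<n}" "\<lambda>i. q S i + q T i"] nonneg by blast
  then have col0: "Matrix.col D i = 0\<^sub>v n" if "i < n" for i
    using pos[of i] that by fastforce
  show ?thesis
  proof (rule eq_matI)
    fix i j assume "i < dim_row T" "j < dim_col T"
    then have ij: "i < n" "j < n" using T by auto
    have "D $$ (i, j) = 0" using arg_cong[OF col0[OF ij(2)], of "\<lambda>u. u $ i"] ij D by simp
    then show "S $$ (i, j) = T $$ (i, j)" using ij S T by (simp add: D_def)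
  qed (use S T in auto)
qed

section \<open>The SNR as a value of a quadratic form\<close>

lemma inv_sqrt_mat:
  assumes "pos_def_mat n A"
  shows "pos_def_mat n (inv_sqrt_mat A)" "inv_sqrt_mat A * inv_sqrt_mat A = inv_mat A"
proof -
  have "dim_row A = n" using assms unfolding pos_def_mat_def by auto
  then have "\<exists>!S. pos_def_mat (dim_row A) S \<and> S * S = inv_mat A"
    using pos_def_mat_sqrt_exists[OF pos_def_mat_inv_mat(3)[OF assms]] pos_def_mat_sqrt_unique by metis
  from theI'[OF this] show "pos_def_mat n (inv_sqrt_mat A)" "inv_sqrt_mat A * inv_sqrt_mat A = inv_mat A"
    using \<open>dim_row A = n\<close> unfolding inv_sqrt_mat_def by auto
qed

text \<open>Eliminates the square root: after \<open>snr_attained\<close>, distances between centers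
  occur only as values of the quadratic form of \<open>inv_mat\<close>.\<close>

lemma vec_norm2_inv_sqrt_mat:
  assumes A: "pos_def_mat n A" and v: "v \<in> carrier_vec n"
  shows "(vec_norm2 (transpose_mat (inv_sqrt_mat A) *\<^sub>v v))\<^sup>2 = v \<bullet> (inv_mat A *\<^sub>v v)"
    "0 \<le> vec_norm2 (transpose_mat (inv_sqrt_mat A) *\<^sub>v v)"
proof -
  let ?S = "inv_sqrt_mat A"
  have S: "?S \<in> carrier_mat n n" "transpose_mat ?S = ?S"
    using inv_sqrt_mat(1)[OF A] unfolding pos_def_mat_def by auto
  have "(?S *\<^sub>v v) \<bullet> (?S *\<^sub>v v) = v \<bullet> ((?S * ?S) *\<^sub>v v)"
    using S v by (simp add: assoc_mult_mat_vec[of _ n n _ n] symmetric_scalar_prod)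
  moreover have nn: "0 \<le> (?S *\<^sub>v v) \<bullet> (?S *\<^sub>v v)"
    by (auto simp: scalar_prod_def intro!: sum_nonneg)
  ultimately show "(vec_norm2 (transpose_mat ?S *\<^sub>v v))\<^sup>2 = v \<bullet> (inv_mat A *\<^sub>v v)"
    "0 \<le> vec_norm2 (transpose_mat (inv_sqrt_mat A) *\<^sub>v v)"
    using inv_sqrt_mat(2)[OF A] S by (simp_all add: vec_norm2_def)
qed

text \<open>The closest pair of centers is the hardest to tell apart, so the lower bound is built on
  it. \<open>2 \<le> k\<close> makes the set of pairs nonempty, hence \<open>Min\<close> a genuine
  minimum.\<close>

lemma snr_attained:
  assumes k: "2 \<le> k" and \<theta>: "\<And>a. a \<in> {1..k} \<Longrightarrow> \<theta> a \<in> carrier_vec d" and \<Sigma>: "pos_def_mat d \<Sigma>"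
  obtains a b where "a \<in> {1..k}" "b \<in> {1..k}" "a \<noteq> b" "0 \<le> snr k \<theta> \<Sigma>"
    "(\<theta> a - \<theta> b) \<bullet> (inv_mat \<Sigma> *\<^sub>v (\<theta> a - \<theta> b)) = (snr k \<theta> \<Sigma>)\<^sup>2"
proof -
  define f where "f = (\<lambda>(a, b). vec_norm2 (transpose_mat (inv_sqrt_mat \<Sigma>) *\<^sub>v (\<theta> a - \<theta> b)))"
  define Q where "Q = {(a, b). a \<in> {1..k} \<and> b \<in> {1..k} \<and> a \<noteq> b}"
  have "finite Q" by (rule finite_subset[of _ "{1..k} \<times> {1..k}"]) (auto simp: Q_def)
  moreover have "(1, 2) \<in> Q" using k by (auto simp: Q_def)
  ultimately have "Min (f ` Q) \<in> f ` Q" by (intro Min_in) auto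
  moreover have "snr k \<theta> \<Sigma> = Min (f ` Q)"
    unfolding snr_def by (rule arg_cong[of _ _ Min]) (force simp: f_def Q_def)
  ultimately obtain a b where "(a, b) \<in> Q" "snr k \<theta> \<Sigma> = f (a, b)" by auto
  then show ?thesis
    using that[of a b] vec_norm2_inv_sqrt_mat[OF \<Sigma>, of "\<theta> a - \<theta> b"] \<theta>
    by (auto simp: Q_def f_def)
qed

section \<open>Gaussian integrals\<close>

lemma quad_form_eq_sum:
  fixes A :: "real Matrix.mat"
  assumes "A \<in> carrier_mat n n"
  shows "Matrix.vec n x \<bullet> (A *\<^sub>v Matrix.vec n y) = (\<Sum>i<n. \<Sum>j<n. x i * A $$ (i, j) * y j)"
  using assms by (simp add: scalar_prod_def atLeast0LessThan sum_distrib_left mult.assoc)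

lemma borel_measurable_quad_form [measurable]:
  fixes A :: "real Matrix.mat"
  assumes "A \<in> carrier_mat n n"
  shows "(\<lambda>x. Matrix.vec n x \<bullet> (A *\<^sub>v Matrix.vec n x)) \<in> borel_measurable (\<Pi>\<^sub>M i\<in>{..<n}. lborel)"
proof -
  have comp: "(\<lambda>x. x i) \<in> borel_measurable (\<Pi>\<^sub>M i\<in>{..<n}. (lborel :: real measure))" if "i < n" for i
    using measurable_component_singleton[of i "{..<n}" "\<lambda>_. lborel :: real measure"] that by simp
  show ?thesis
    unfolding quad_form_eq_sum[OF assms]
    by (intro borel_measurable_sum borel_measurable_times borel_measurable_const comp) auto
qed

lemma borel_measurable_scalar_prod:
  assumes "w \<in> carrier_vec n"
  shows "(\<lambda>x. Matrix.vec n x \<bullet> w) \<in> borel_measurable (\<Pi>\<^sub>M i\<in>{..<n}. (lborel :: real measure))"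
proof -
  have comp: "(\<lambda>x. x i) \<in> borel_measurable (\<Pi>\<^sub>M i\<in>{..<n}. (lborel :: real measure))" if "i < n" for i
    using measurable_component_singleton[of i "{..<n}" "\<lambda>_. lborel :: real measure"] that by simp
  have "Matrix.vec n x \<bullet> w = (\<Sum>i<n. x i * w $ i)" for x
    using assms by (simp add: scalar_prod_def atLeast0LessThan)
  then show ?thesis
    by (simp only:) (intro borel_measurable_sum borel_measurable_times borel_measurable_const comp, auto)
qed

section \<open>Schur complements and the Gaussian normalising constant\<close>

text \<open>The pivot is the last index because \<open>{..<Suc n}\<close> is
  \<open>insert n {..<n}\<close>, so that index n is the coordinate split off by the product
  integral.\<close>

definition schur_complement :: "nat \<Rightarrow> real Matrix.mat \<Rightarrow> real Matrix.mat" where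
  "schur_complement n A = Matrix.mat n n (\<lambda>(i, j). A $$ (i, j) - A $$ (i, n) * A $$ (n, j) / A $$ (n, n))"

text \<open>Completing the square in the last coordinate.\<close>

lemma quad_form_schur:
  assumes A: "A \<in> carrier_mat (Suc n) (Suc n)" "transpose_mat A = A" and p: "A $$ (n, n) \<noteq> 0"
  shows "Matrix.vec (Suc n) x \<bullet> (A *\<^sub>v Matrix.vec (Suc n) x)
    = Matrix.vec n x \<bullet> (schur_complement n A *\<^sub>v Matrix.vec n x)
      + A $$ (n, n) * (x n + (\<Sum>j<n. A $$ (n, j) * x j) / A $$ (n, n))\<^sup>2"
proof -
  let ?p = "A $$ (n, n)"
  define b where "b = (\<Sum>j<n. A $$ (n, j) * x j)"
  have sym: "A $$ (i, n) = A $$ (n, i)" if "i < n" for i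
    using A that by (metis carrier_matD index_transpose_mat(1) less_Suc_eq)
  have b': "(\<Sum>i<n. x i * A $$ (i, n)) = b"
    unfolding b_def by (intro sum.cong) (auto simp: sym)
  have "(\<Sum>i<n. \<Sum>j<n. x i * schur_complement n A $$ (i, j) * x j)
      = (\<Sum>i<n. \<Sum>j<n. x i * A $$ (i, j) * x j - (x i * A $$ (i, n)) * (A $$ (n, j) * x j) / ?p)"
    by (intro sum.cong) (auto simp: schur_complement_def algebra_simps)
  also have "\<dots> = (\<Sum>i<n. \<Sum>j<n. x i * A $$ (i, j) * x j) - b * b / ?p"
    unfolding sum_subtractf sum_divide_distrib[symmetric] sum_product[symmetric] b' b_def[symmetric] by simp
  finally have 1: "(\<Sum>i<n. \<Sum>j<n. x i * schur_complement n A $$ (i, j) * x j)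
      = (\<Sum>i<n. \<Sum>j<n. x i * A $$ (i, j) * x j) - b * b / ?p" .
  have "(\<Sum>i<Suc n. \<Sum>j<Suc n. x i * A $$ (i, j) * x j)
      = (\<Sum>i<n. \<Sum>j<n. x i * A $$ (i, j) * x j) + (\<Sum>i<n. x i * A $$ (i, n)) * x n
        + (x n * b + x n * ?p * x n)"
    by (simp add: sum.distrib sum_distrib_right b_def sum_distrib_left mult.assoc)
  also have "\<dots> = (\<Sum>i<n. \<Sum>j<n. x i * schur_complement n A $$ (i, j) * x j) + ?p * (x n + b / ?p)\<^sup>2"
    unfolding 1 b' using p by (simp add: power2_eq_square field_simps)
  finally show ?thesis
    using A by (simp add: quad_form_eq_sum b_def schur_complement_def del: sum.lessThan_Suc)
qed

text \<open>A factors into a unit block upper triangular matrix U and a block lower triangular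
  matrix L with diagonal blocks the Schur complement and the pivot.\<close>

lemma det_schur:
  assumes A: "A \<in> carrier_mat (Suc n) (Suc n)" and p: "A $$ (n, n) \<noteq> 0"
  shows "Determinant.det A = A $$ (n, n) * Determinant.det (schur_complement n A)"
proof -
  let ?p = "A $$ (n, n)" and ?S = "schur_complement n A"
  define B where "B = Matrix.mat n 1 (\<lambda>(i, _). A $$ (i, n) / ?p)"
  define C where "C = Matrix.mat 1 n (\<lambda>(_, j). A $$ (n, j))"
  define D where "D = Matrix.mat 1 1 (\<lambda>_. ?p)"
  have carr: "?S \<in> carrier_mat n n" "B \<in> carrier_mat n 1" "C \<in> carrier_mat 1 n" "D \<in> carrier_mat 1 1"
    by (auto simp: schur_complement_def B_def C_def D_def)
  define U where "U = four_block_mat (1\<^sub>m n) B (0\<^sub>m 1 n) (1\<^sub>m 1)"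
  define L where "L = four_block_mat ?S (0\<^sub>m n 1) C D"
  have UL: "U \<in> carrier_mat (Suc n) (Suc n)" "L \<in> carrier_mat (Suc n) (Suc n)"
    using carr by (intro carrier_matI; simp add: U_def L_def)+
  have "U * L = four_block_mat (1\<^sub>m n * ?S + B * C) (1\<^sub>m n * 0\<^sub>m n 1 + B * D)
      (0\<^sub>m 1 n * ?S + 1\<^sub>m 1 * C) (0\<^sub>m 1 n * 0\<^sub>m n 1 + 1\<^sub>m 1 * D)"
    unfolding U_def L_def by (rule mult_four_block_mat) (use carr in auto)
  also have "\<dots> = four_block_mat (?S + B * C) (B * D) C D"
    using carr by simp
  also have "\<dots> = A"
  proof (rule eq_matI)
    fix i j assume "i < dim_row A" "j < dim_col A"
    then have ij: "i < Suc n" "j < Suc n" using A by auto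
    have "(B * C) $$ (i, j) = A $$ (i, n) * A $$ (n, j) / ?p" if "i < n" "j < n"
      using that by (simp add: B_def C_def scalar_prod_def)
    moreover have "(B * D) $$ (i, 0) = A $$ (i, n)" if "i < n"
      using that p by (simp add: B_def D_def scalar_prod_def)
    ultimately show "four_block_mat (?S + B * C) (B * D) C D $$ (i, j) = A $$ (i, j)"
      using ij carr by (cases "i < n"; cases "j < n") (auto simp: less_Suc_eq schur_complement_def C_def D_def)
  qed (use A carr in auto)
  finally have "Determinant.det A = Determinant.det U * Determinant.det L"
    using det_mult[OF UL] by simp
  moreover have "Determinant.det U = 1"
    unfolding U_def by (subst det_four_block_mat_lower_left_zero[of _ n _ 1]) (use carr in auto)
  moreover have "Determinant.det L = Determinant.det ?S * Determinant.det D"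
    unfolding L_def by (rule det_four_block_mat_upper_right_zero[of _ n _ 1]) (use carr in auto)
  moreover have "Determinant.det D = ?p"
    by (subst det_single) (auto simp: D_def)
  ultimately show ?thesis by simp
qed

lemma pos_def_mat_schur:
  assumes "pos_def_mat (Suc n) A"
  shows "0 < A $$ (n, n)" "pos_def_mat n (schur_complement n A)"
proof -
  from assms have A: "A \<in> carrier_mat (Suc n) (Suc n)" "transpose_mat A = A"
    and pos: "\<And>v. v \<in> carrier_vec (Suc n) \<Longrightarrow> v \<noteq> 0\<^sub>v (Suc n) \<Longrightarrow> 0 < v \<bullet> (A *\<^sub>v v)"
    unfolding pos_def_mat_def by auto
  have "unit_vec (Suc n) n \<bullet> (A *\<^sub>v unit_vec (Suc n) n) = A $$ (n, n)"
    using A by simp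
  then show p: "0 < A $$ (n, n)"
    using pos[of "unit_vec (Suc n) n"] by (simp add: unit_vec_nonzero)
  have sym: "A $$ (i, j) = A $$ (j, i)" if "i < Suc n" "j < Suc n" for i j
    using A that by (metis carrier_matD index_transpose_mat(1))
  have "transpose_mat (schur_complement n A) = schur_complement n A"
    by (rule eq_matI) (auto simp: schur_complement_def sym)
  moreover have "0 < v \<bullet> (schur_complement n A *\<^sub>v v)" if v: "v \<in> carrier_vec n" "v \<noteq> 0\<^sub>v n" for v
  proof -
    \<comment> \<open>The last coordinate is chosen to make the completed square vanish, which
      leaves the value of the Schur complement at v.\<close>
    define x where "x = (\<lambda>i. if i < n then v $ i else - (\<Sum>j<n. A $$ (n, j) * v $ j) / A $$ (n, n))"
    have vx: "Matrix.vec n x = v" using v by (auto simp: x_def)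
    have "Matrix.vec (Suc n) x \<noteq> 0\<^sub>v (Suc n)"
    proof
      assume *: "Matrix.vec (Suc n) x = 0\<^sub>v (Suc n)"
      have "v $ i = 0" if "i < n" for i
        using arg_cong[OF *, of "\<lambda>u. u $ i"] that by (simp add: x_def)
      then show False using v by auto
    qed
    then have "0 < Matrix.vec (Suc n) x \<bullet> (A *\<^sub>v Matrix.vec (Suc n) x)" using pos by simp
    also have "\<dots> = v \<bullet> (schur_complement n A *\<^sub>v v)"
      using p by (subst quad_form_schur[OF A]) (simp_all add: vx, simp add: x_def)
    finally show ?thesis .
  qed
  ultimately show "pos_def_mat n (schur_complement n A)"
    unfolding pos_def_mat_def by (auto simp: schur_complement_def)
qed

lemma nn_integral_exp_square:
  assumes "0 < (p :: real)"
  shows "(\<integral>\<^sup>+ y. ennreal (exp (- (p * (y + m)\<^sup>2) / 2)) \<partial>lborel) = ennreal (sqrt (2 * pi / p))"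
proof -
  let ?s = "1 / sqrt p"
  have "(\<integral>\<^sup>+ y. ennreal (normal_density (- m) ?s y) \<partial>lborel) = 1"
    using assms by (subst nn_integral_eq_integral) auto
  moreover have "exp (- (p * (y + m)\<^sup>2) / 2) = sqrt (2 * pi / p) * normal_density (- m) ?s y" for y
    using assms by (simp add: normal_density_def real_sqrt_divide real_sqrt_mult power_divide field_simps)
  ultimately show ?thesis
    using assms by (simp add: ennreal_mult' nn_integral_cmult)
qed

text \<open>Fubini on the last coordinate: after completing the square, the inner integrand has a
  shift depending on the other coordinates, but its integral does not depend on them up to the
  factor pulled out. Integral and determinant obey recursions in the same pivot
  \<open>A $$ (n, n)\<close>, which also gives the positivity of the determinant.\<close>

lemma nn_integral_exp_quad_form:
  assumes "pos_def_mat n A"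
  shows "0 < Determinant.det A \<and>
    (\<integral>\<^sup>+ x. ennreal (exp (- (Matrix.vec n x \<bullet> (A *\<^sub>v Matrix.vec n x)) / 2)) \<partial>(\<Pi>\<^sub>M i\<in>{..<n}. lborel))
      = ennreal (sqrt ((2 * pi) ^ n / Determinant.det A))"
  using assms
proof (induction n arbitrary: A)
  case 0
  then have "A \<in> carrier_mat 0 0" unfolding pos_def_mat_def by auto
  then show ?case by (simp add: PiM_empty nn_integral_count_space_finite scalar_prod_def)
next
  case (Suc n)
  interpret product_sigma_finite "\<lambda>_ :: nat. lborel :: real measure" by standard
  from Suc.prems have A: "A \<in> carrier_mat (Suc n) (Suc n)" "transpose_mat A = A"
    unfolding pos_def_mat_def by auto
  note p = pos_def_mat_schur(1)[OF Suc.prems] and pS = pos_def_mat_schur(2)[OF Suc.prems]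
  let ?p = "A $$ (n, n)" and ?S = "schur_complement n A"
  note [measurable] = borel_measurable_quad_form[OF A(1)]
  have S: "?S \<in> carrier_mat n n" using pS unfolding pos_def_mat_def by auto
  note [measurable] = borel_measurable_quad_form[OF S]
  have "(\<integral>\<^sup>+ x. ennreal (exp (- (Matrix.vec (Suc n) x \<bullet> (A *\<^sub>v Matrix.vec (Suc n) x)) / 2))
        \<partial>(\<Pi>\<^sub>M i\<in>{..<Suc n}. lborel))
      = (\<integral>\<^sup>+ x. (\<integral>\<^sup>+ y. ennreal (exp (- (Matrix.vec (Suc n) (x(n := y)) \<bullet> (A *\<^sub>v Matrix.vec (Suc n) (x(n := y)))) / 2))
        \<partial>lborel) \<partial>(\<Pi>\<^sub>M i\<in>{..<n}. lborel))"
    unfolding lessThan_Suc by (rule product_nn_integral_insert) (simp_all add: lessThan_Suc[symmetric] del: lessThan_Suc)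
  also have "\<dots> = (\<integral>\<^sup>+ x. ennreal (exp (- (Matrix.vec n x \<bullet> (?S *\<^sub>v Matrix.vec n x)) / 2))
        * ennreal (sqrt (2 * pi / ?p)) \<partial>(\<Pi>\<^sub>M i\<in>{..<n}. lborel))"
  proof (rule nn_integral_cong)
    fix x :: "nat \<Rightarrow> real"
    define m where "m = (\<Sum>j<n. A $$ (n, j) * x j) / ?p"
    define q where "q = Matrix.vec n x \<bullet> (?S *\<^sub>v Matrix.vec n x)"
    have "Matrix.vec (Suc n) (x(n := y)) \<bullet> (A *\<^sub>v Matrix.vec (Suc n) (x(n := y))) = q + ?p * (y + m)\<^sup>2" for y
    proof -
      have "Matrix.vec n (x(n := y)) = Matrix.vec n x" by auto
      then show ?thesis
        using p by (subst quad_form_schur[OF A]) (auto simp: q_def m_def)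
    qed
    then have "exp (- (Matrix.vec (Suc n) (x(n := y)) \<bullet> (A *\<^sub>v Matrix.vec (Suc n) (x(n := y)))) / 2)
        = exp (- q / 2) * exp (- (?p * (y + m)\<^sup>2) / 2)" for y
      by (simp add: exp_add[symmetric] field_simps)
    then show "(\<integral>\<^sup>+ y. ennreal (exp (- (Matrix.vec (Suc n) (x(n := y)) \<bullet> (A *\<^sub>v Matrix.vec (Suc n) (x(n := y)))) / 2)) \<partial>lborel)
        = ennreal (exp (- q / 2)) * ennreal (sqrt (2 * pi / ?p))"
      by (simp add: ennreal_mult' nn_integral_cmult nn_integral_exp_square[OF p, simplified])
  qed
  also have "\<dots> = ennreal (sqrt ((2 * pi) ^ n / Determinant.det ?S)) * ennreal (sqrt (2 * pi / ?p))"
    using Suc.IH[OF pS] by (simp add: nn_integral_multc)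
  also have "\<dots> = ennreal (sqrt ((2 * pi) ^ Suc n / Determinant.det A))"
    using p Suc.IH[OF pS] det_schur[OF A(1)]
    by (simp add: ennreal_mult'[symmetric] real_sqrt_mult[symmetric] field_simps)
  finally show ?case
    using p Suc.IH[OF pS] det_schur[OF A(1)] by simp
qed

lemma gauss_normaliser_pos:
  assumes "pos_def_mat d \<Sigma>"
  shows "0 < sqrt ((2 * pi) ^ d * Determinant.det \<Sigma>)"
  using nn_integral_exp_quad_form[OF assms] by auto

lemma gauss_density_measurable [measurable]:
  assumes "pos_def_mat d \<Sigma>"
  shows "gauss_density d \<Sigma> \<in> borel_measurable (\<Pi>\<^sub>M i\<in>{..<d}. lborel)"
proof -
  have [simp]: "inv_mat \<Sigma> \<in> carrier_mat d d"
    using pos_def_mat_inv_mat(3)[OF assms] unfolding pos_def_mat_def by auto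
  show ?thesis unfolding gauss_density_def[abs_def] by measurable
qed

lemma nn_integral_gauss_density:
  assumes "pos_def_mat d \<Sigma>"
  shows "(\<integral>\<^sup>+ x. ennreal (gauss_density d \<Sigma> x) \<partial>(\<Pi>\<^sub>M i\<in>{..<d}. lborel)) = 1"
proof -
  let ?P = "inv_mat \<Sigma>" and ?c = "sqrt ((2 * pi) ^ d * Determinant.det \<Sigma>)"
  note P = pos_def_mat_inv_mat[OF assms]
  have [simp]: "?P \<in> carrier_mat d d" using P(3) unfolding pos_def_mat_def by auto
  have c: "0 < ?c" by (rule gauss_normaliser_pos[OF assms])
  have "(\<integral>\<^sup>+ x. ennreal (gauss_density d \<Sigma> x) \<partial>(\<Pi>\<^sub>M i\<in>{..<d}. lborel))
      = (\<integral>\<^sup>+ x. ennreal (1 / ?c) * ennreal (exp (- (Matrix.vec d x \<bullet> (?P *\<^sub>v Matrix.vec d x)) / 2)) \<partial>(\<Pi>\<^sub>M i\<in>{..<d}. lborel))"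
    using c by (intro nn_integral_cong) (simp add: gauss_density_def ennreal_mult'[symmetric])
  also have "\<dots> = ennreal (1 / ?c) * ennreal (sqrt ((2 * pi) ^ d / Determinant.det ?P))"
    using nn_integral_exp_quad_form[OF P(3)] by (simp add: nn_integral_cmult)
  also have "Determinant.det ?P = 1 / Determinant.det \<Sigma>"
    using P(4) nn_integral_exp_quad_form[OF assms] by (simp add: field_simps)
  finally show ?thesis
    using nn_integral_exp_quad_form[OF assms] by (auto simp: ennreal_mult'[symmetric])
qed

lemma sets_gauss_law: "sets (gauss_law d \<Sigma>) = sets (points d)"
  unfolding gauss_law_def points_def by (simp cong: sets_PiM_cong)

lemma prob_space_gauss_law:
  assumes "pos_def_mat d \<Sigma>"
  shows "prob_space (gauss_law d \<Sigma>)"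
  using nn_integral_gauss_density[OF assms] gauss_density_measurable[OF assms]
  by (intro prob_spaceI) (simp add: gauss_law_def emeasure_density cong: nn_integral_cong)

section \<open>Overlap of two translated Gaussians\<close>

text \<open>The product measure is determined by its values on boxes, and the preimage of a box
  under a coordinatewise shift is a box with sides of the same measure.\<close>

lemma distr_PiM_lborel_translate:
  "distr (\<Pi>\<^sub>M i\<in>{..<d}. lborel) (\<Pi>\<^sub>M i\<in>{..<d}. lborel) (\<lambda>x. \<lambda>i\<in>{..<d}. t i + x i)
    = (\<Pi>\<^sub>M i\<in>{..<d :: nat}. (lborel :: real measure))"
proof -
  interpret product_sigma_finite "\<lambda>_ :: nat. lborel :: real measure" by standard
  let ?M = "\<Pi>\<^sub>M i\<in>{..<d}. (lborel :: real measure)"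
  let ?f = "\<lambda>x. \<lambda>i\<in>{..<d}. t i + x i"
  have f: "?f \<in> measurable ?M ?M"
    by (intro measurable_restrict) simp
  show ?thesis
  proof (rule PiM_eqI)
    fix A :: "nat \<Rightarrow> real set" assume A: "\<And>i. i \<in> {..<d} \<Longrightarrow> A i \<in> sets lborel"
    have "?f -` Pi\<^sub>E {..<d} A \<inter> space ?M = Pi\<^sub>E {..<d} (\<lambda>i. (+) (t i) -` A i)"
      by (auto simp: space_PiM PiE_iff Pi_iff)
    moreover have vimage_sets: "(+) (t i) -` A i \<in> sets lborel" if "i < d" for i
      using measurable_sets[of "(+) (t i)" borel borel "A i"] A[of i] that by simp
    moreover have vimage_emeasure: "emeasure lborel ((+) (t i) -` A i) = emeasure lborel (A i)" if "i < d" for i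
      using A[of i] that by (subst (2) lborel_distr_plus[of "t i", symmetric]) (simp add: emeasure_distr)
    ultimately have "emeasure (distr ?M ?M ?f) (Pi\<^sub>E {..<d} A) = emeasure ?M (Pi\<^sub>E {..<d} (\<lambda>i. (+) (t i) -` A i))"
      using A by (subst emeasure_distr[OF f]) (auto intro!: sets_PiM_I_finite)
    also have "\<dots> = (\<Prod>i\<in>{..<d}. emeasure lborel ((+) (t i) -` A i))"
      using vimage_sets by (intro emeasure_PiM) auto
    also have "\<dots> = (\<Prod>i\<in>{..<d}. emeasure lborel (A i))"
      using vimage_emeasure by (intro prod.cong) auto
    finally show "emeasure (distr ?M ?M ?f) (Pi\<^sub>E {..<d} A) = (\<Prod>i\<in>{..<d}. emeasure lborel (A i))" .
  qed simp_all
qed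

lemma nn_integral_PiM_lborel_translate:
  fixes d :: nat
  assumes "f \<in> borel_measurable (\<Pi>\<^sub>M i\<in>{..<d}. (lborel :: real measure))"
  shows "(\<integral>\<^sup>+ x. f (\<lambda>i\<in>{..<d}. t i + x i) \<partial>(\<Pi>\<^sub>M i\<in>{..<d}. lborel)) = (\<integral>\<^sup>+ x. f x \<partial>(\<Pi>\<^sub>M i\<in>{..<d}. lborel))"
  by (subst (2) distr_PiM_lborel_translate[of d t, symmetric])
    (intro nn_integral_distr[symmetric] measurable_restrict; use assms in simp)

text \<open>Translation as exponential tilting. The parameter s serves two purposes: s = 1 and s =
  -1 give the two recentred cluster densities, other values give exponential moments of the linear
  form.\<close>

lemma gauss_density_translate:
  assumes \<Sigma>: "pos_def_mat d \<Sigma>"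
  shows "gauss_density d \<Sigma> (\<lambda>i\<in>{..<d}. - (s * h i) + x i)
    = gauss_density d \<Sigma> x * exp (s * (Matrix.vec d x \<bullet> (inv_mat \<Sigma> *\<^sub>v Matrix.vec d h))
        - s\<^sup>2 * (Matrix.vec d h \<bullet> (inv_mat \<Sigma> *\<^sub>v Matrix.vec d h)) / 2)"
proof -
  let ?P = "inv_mat \<Sigma>" and ?x = "Matrix.vec d x" and ?h = "Matrix.vec d h"
  have P: "?P \<in> carrier_mat d d" "transpose_mat ?P = ?P"
    using pos_def_mat_inv_mat(3)[OF \<Sigma>] unfolding pos_def_mat_def by auto
  have sym: "?h \<bullet> (?P *\<^sub>v ?x) = ?x \<bullet> (?P *\<^sub>v ?h)"
    using symmetric_scalar_prod[OF P, of ?h ?x] P by (simp add: comm_scalar_prod[of _ d])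
  have carr: "?P *\<^sub>v ?x \<in> carrier_vec d" "?P *\<^sub>v ?h \<in> carrier_vec d" using P by auto
  have "Matrix.vec d (\<lambda>i\<in>{..<d}. - (s * h i) + x i) = ?x + (- s) \<cdot>\<^sub>v ?h"
    by (intro eq_vecI) auto
  also have "\<dots> \<bullet> (?P *\<^sub>v \<dots>) = ?x \<bullet> (?P *\<^sub>v ?x) - 2 * s * (?x \<bullet> (?P *\<^sub>v ?h)) + s\<^sup>2 * (?h \<bullet> (?P *\<^sub>v ?h))"
    using P carr sym
    by (simp add: mult_add_distrib_mat_vec[of _ d d] mult_mat_vec[of _ d d] add_scalar_prod_distrib[of _ d]
        scalar_prod_add_distrib[of _ d] power2_eq_square algebra_simps)
  finally show ?thesis
    by (simp add: gauss_density_def exp_add[symmetric] exp_minus[symmetric] field_simps)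
qed

lemma nn_integral_gauss_density_translate:
  assumes "pos_def_mat d \<Sigma>"
  shows "(\<integral>\<^sup>+ x. ennreal (gauss_density d \<Sigma> (\<lambda>i\<in>{..<d}. t i + x i)) \<partial>(\<Pi>\<^sub>M i\<in>{..<d}. lborel)) = 1"
  using gauss_density_measurable[OF assms]
  by (subst nn_integral_PiM_lborel_translate) (simp_all add: nn_integral_gauss_density[OF assms])

text \<open>The exponential moments of the linear form come from the translations by \<open>\<plusminus>s * h\<close>; a Chernoff
  bound at level \<open>D + 1\<close> with \<open>s = 4 / (D + 1)\<close> then shows that \<open>\<bar>l\<bar> \<le> D + 1\<close> with probability
  at least \<open>1 / 2\<close>.\<close>

lemma gauss_overlap_bound:
  assumes \<Sigma>: "pos_def_mat d \<Sigma>" and D: "0 \<le> D"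
    and h: "Matrix.vec d h \<bullet> (inv_mat \<Sigma> *\<^sub>v Matrix.vec d h) = D\<^sup>2 / 4"
  defines "l \<equiv> \<lambda>x. Matrix.vec d x \<bullet> (inv_mat \<Sigma> *\<^sub>v Matrix.vec d h)"
  shows "ennreal (exp (- D - 1) / 2)
    \<le> (\<integral>\<^sup>+ x. ennreal (gauss_density d \<Sigma> x * exp (- \<bar>l x\<bar>)) \<partial>(\<Pi>\<^sub>M i\<in>{..<d}. lborel))"
proof -
  let ?N = "\<Pi>\<^sub>M i\<in>{..<d}. (lborel :: real measure)"
  define p where "p = gauss_density d \<Sigma>"
  define s where "s = 4 / (D + 1)"
  define T where "T = (\<lambda>(s :: real) x. p (\<lambda>i\<in>{..<d}. - (s * h i) + x i))"
  have p0: "0 \<le> p x" for x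
    using gauss_normaliser_pos[OF \<Sigma>] by (simp add: p_def gauss_density_def)
  then have T0: "0 \<le> T s x" for s x by (simp add: T_def)
  have p_meas [measurable]: "p \<in> borel_measurable ?N"
    unfolding p_def by (rule gauss_density_measurable[OF \<Sigma>])
  have shift: "(\<lambda>x. \<lambda>i\<in>{..<d}. - (s * h i) + x i) \<in> measurable ?N ?N" for s
    by (intro measurable_restrict) simp
  have [measurable]: "T s \<in> borel_measurable ?N" for s
    unfolding T_def by (rule measurable_compose[OF shift p_meas])
  have Pc: "inv_mat \<Sigma> \<in> carrier_mat d d"
    using pos_def_mat_inv_mat(3)[OF \<Sigma>] unfolding pos_def_mat_def by auto
  have [measurable]: "l \<in> borel_measurable ?N"
    unfolding l_def using Pc by (intro borel_measurable_scalar_prod) simp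
  have T: "T s x = p x * exp (s * l x - s\<^sup>2 * D\<^sup>2 / 8)" for s x
    unfolding T_def p_def l_def by (subst gauss_density_translate[OF \<Sigma>]) (simp add: h)
  have intT: "(\<integral>\<^sup>+ x. ennreal (T s x) \<partial>?N) = 1" for s
    unfolding T_def p_def by (rule nn_integral_gauss_density_translate[OF \<Sigma>])
  define I where "I = (\<integral>\<^sup>+ x. ennreal (p x * exp (- \<bar>l x\<bar>)) \<partial>?N)"
  have s: "s * (D + 1) = 4" "s > 0" using D by (simp_all add: s_def divide_simps)
  \<comment> \<open>With s (D + 1) = 4, the quadratic correction is at most 16 / 8 = 2, so a net
    exponent of at least 2 remains beyond the level D + 1.\<close>
  have sD: "s\<^sup>2 * D\<^sup>2 / 8 \<le> 2"
  proof -
    have "s * D \<le> 4" using s D by (simp add: algebra_simps)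
    then have "(s * D)\<^sup>2 \<le> 4\<^sup>2" using s D by (intro power_mono) auto
    then show ?thesis by (simp add: power_mult_distrib)
  qed
  have exp3: "exp (- D - 3) * exp 2 = exp (- D - 1)"
    unfolding exp_add[symmetric] by (rule arg_cong[of _ _ exp]) simp
  \<comment> \<open>Markov's inequality in pointwise form: where |l| > D + 1, one of the two
    translates is at least exp 2 times p. Integrating then needs only the total masses of p and its
    translates.\<close>
  have ptw: "p x * exp (- D - 1) \<le> p x * exp (- \<bar>l x\<bar>) + exp (- D - 3) * (T s x + T (- s) x)" for x
  proof (cases "\<bar>l x\<bar> \<le> D + 1")
    case True
    then have "p x * exp (- D - 1) \<le> p x * exp (- \<bar>l x\<bar>)"
      using p0 by (intro mult_left_mono) auto
    then show ?thesis using T0[of s x] T0[of "- s" x] by (simp add: add_increasing2)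
  next
    case False
    then have "s * (D + 1) \<le> s * \<bar>l x\<bar>" using s(2) by (intro mult_left_mono) auto
    then have ge: "2 \<le> s * \<bar>l x\<bar> - s\<^sup>2 * D\<^sup>2 / 8" using s(1) sD by simp
    have "p x * exp 2 \<le> p x * exp (s * \<bar>l x\<bar> - s\<^sup>2 * D\<^sup>2 / 8)"
      using p0 ge by (intro mult_left_mono) auto
    also have "\<dots> \<le> T s x + T (- s) x"
      using T0[of s x] T0[of "- s" x] by (cases "0 \<le> l x") (auto simp: T)
    finally have "exp (- D - 3) * (p x * exp 2) \<le> exp (- D - 3) * (T s x + T (- s) x)"
      by (intro mult_left_mono) auto
    moreover have "exp (- D - 3) * (p x * exp 2) = p x * exp (- D - 1)"
      using exp3 by simp
    ultimately show ?thesis using p0[of x] by (simp add: add_increasing)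
  qed
  have "ennreal (exp (- D - 1)) = (\<integral>\<^sup>+ x. ennreal (p x * exp (- D - 1)) \<partial>?N)"
    using p0 nn_integral_gauss_density[OF \<Sigma>] by (simp add: ennreal_mult nn_integral_multc p_def[symmetric])
  also have "\<dots> \<le> (\<integral>\<^sup>+ x. ennreal (p x * exp (- \<bar>l x\<bar>))
      + ennreal (exp (- D - 3)) * (ennreal (T s x) + ennreal (T (- s) x)) \<partial>?N)"
    using p0 T0 ptw by (intro nn_integral_mono) (simp add: ennreal_plus[symmetric] ennreal_mult[symmetric] del: ennreal_plus)
  also have "\<dots> = I + ennreal (exp (- D - 3)) * (1 + 1)"
    by (simp add: nn_integral_add nn_integral_cmult intT I_def)
  also have "ennreal (exp (- D - 3)) * (1 + 1) = ennreal (2 * exp (- D - 3))"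
    by (simp add: ennreal_mult' mult.commute)
  finally have le: "ennreal (exp (- D - 1)) \<le> I + ennreal (2 * exp (- D - 3))" .
  \<comment> \<open>Since exp 2 \<ge> 4, the tail term 2 exp (- D - 3) is at most half of exp (- D -
    1); this is the origin of the factor 1/2.\<close>
  have "4 \<le> exp (2 :: real)"
    using power_mono[of 2 "exp (1 :: real)" 2] exp_ge_add_one_self[of "1 :: real"]
    by (simp add: exp_of_nat_mult[of 2 "1 :: real", symmetric, simplified])
  then have "exp (- D - 3) * 4 \<le> exp (- D - 3) * exp 2" by (intro mult_left_mono) auto
  then have "4 * exp (- D - 3) \<le> exp (- D - 1)"
    using exp3 by simp
  then have "ennreal (exp (- D - 1) / 2) \<le> ennreal (exp (- D - 1) - 2 * exp (- D - 3))"
    by (intro ennreal_leI) linarith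
  also have "\<dots> = ennreal (exp (- D - 1)) - ennreal (2 * exp (- D - 3))"
    by (rule ennreal_minus[symmetric]) simp
  also have "\<dots> \<le> I"
    using le by (simp add: ennreal_minus_le_iff add.commute)
  finally show ?thesis unfolding I_def p_def .
qed

text \<open>Le Cam's two-point argument: \<open>F\<close> and \<open>F'\<close> stand for the errors
  of one test under the centers u and v, with total at least 1 at every point. The sum of the
  expected errors is therefore at least the integral of any common lower bound of the two
  densities.\<close>

lemma gauss_two_point_bound:
  assumes \<Sigma>: "pos_def_mat d \<Sigma>" and D: "0 \<le> D"
    and uv: "Matrix.vec d (\<lambda>i. u i - v i) \<bullet> (inv_mat \<Sigma> *\<^sub>v Matrix.vec d (\<lambda>i. u i - v i)) = D\<^sup>2"
    and [measurable]: "F \<in> borel_measurable (points d)" "F' \<in> borel_measurable (points d)"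
    and FF': "\<And>x. x \<in> space (points d) \<Longrightarrow> 1 \<le> F x + F' x"
  shows "ennreal (exp (- D\<^sup>2 / 8 - D - 1) / 2)
    \<le> (\<integral>\<^sup>+ e. F (\<lambda>i\<in>{..<d}. u i + e i) \<partial>gauss_law d \<Sigma>) + (\<integral>\<^sup>+ e. F' (\<lambda>i\<in>{..<d}. v i + e i) \<partial>gauss_law d \<Sigma>)"
proof -
  let ?N = "\<Pi>\<^sub>M i\<in>{..<d}. (lborel :: real measure)"
  define p where "p = gauss_density d \<Sigma>"
  define h where "h = (\<lambda>i. (u i - v i) / 2)"
  define m where "m = (\<lambda>i. (u i + v i) / 2)"
  define l where "l = (\<lambda>x. Matrix.vec d x \<bullet> (inv_mat \<Sigma> *\<^sub>v Matrix.vec d h))"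
  have P: "inv_mat \<Sigma> \<in> carrier_mat d d"
    using pos_def_mat_inv_mat(3)[OF \<Sigma>] unfolding pos_def_mat_def by auto
  have "Matrix.vec d h = (1 / 2) \<cdot>\<^sub>v Matrix.vec d (\<lambda>i. u i - v i)"
    by (intro eq_vecI) (auto simp: h_def)
  then have h: "Matrix.vec d h \<bullet> (inv_mat \<Sigma> *\<^sub>v Matrix.vec d h) = D\<^sup>2 / 4"
    using uv P by (simp add: mult_mat_vec[of _ d d])
  have [measurable]: "p \<in> borel_measurable ?N"
    unfolding p_def by (rule gauss_density_measurable[OF \<Sigma>])
  have [measurable]: "l \<in> borel_measurable ?N"
    unfolding l_def using P by (intro borel_measurable_scalar_prod) simp
  have p0: "0 \<le> p x" for x
    using gauss_normaliser_pos[OF \<Sigma>] by (simp add: p_def gauss_density_def)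
  have sets: "sets ?N = sets (points d)" unfolding points_def by (simp cong: sets_PiM_cong)
  have shift [measurable]: "(\<lambda>x. \<lambda>i\<in>{..<d}. t i + x i) \<in> measurable ?N ?N" for t :: "nat \<Rightarrow> real"
    by (intro measurable_restrict) simp
  have meas: "f \<in> borel_measurable ?N" if "f \<in> borel_measurable (points d)" for f :: "_ \<Rightarrow> ennreal"
    using that measurable_cong_sets[OF sets refl] by blast
  note [measurable] = meas[OF assms(4)] meas[OF assms(5)]
  \<comment> \<open>Substituting e = x - s h places the observation at m + x. With s = 1 for u and s
    = -1 for v, both errors are evaluated at the same point and only the densities differ.\<close>
  have recentre: "(\<integral>\<^sup>+ e. G (\<lambda>i\<in>{..<d}. w i + e i) \<partial>gauss_law d \<Sigma>)
      = (\<integral>\<^sup>+ x. ennreal (p (\<lambda>i\<in>{..<d}. - (s * h i) + x i)) * G (\<lambda>i\<in>{..<d}. m i + x i) \<partial>?N)"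
    if [measurable]: "G \<in> borel_measurable ?N" and w: "\<And>i. w i - s * h i = m i" for G w s
  proof -
    have eq: "(\<lambda>i\<in>{..<d}. w i + (\<lambda>i\<in>{..<d}. - (s * h i) + x i) i) = (\<lambda>i\<in>{..<d}. m i + x i)" for x
      using w by (auto simp: restrict_def fun_eq_iff algebra_simps)
    have "(\<integral>\<^sup>+ e. G (\<lambda>i\<in>{..<d}. w i + e i) \<partial>gauss_law d \<Sigma>)
        = (\<integral>\<^sup>+ e. ennreal (p e) * G (\<lambda>i\<in>{..<d}. w i + e i) \<partial>?N)"
      unfolding gauss_law_def by (subst nn_integral_density) (simp_all add: p_def[symmetric])
    also have "\<dots> = (\<integral>\<^sup>+ x. ennreal (p (\<lambda>i\<in>{..<d}. - (s * h i) + x i))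
        * G (\<lambda>i\<in>{..<d}. w i + (\<lambda>i\<in>{..<d}. - (s * h i) + x i) i) \<partial>?N)"
      by (rule nn_integral_PiM_lborel_translate[symmetric]) simp
    finally show ?thesis unfolding eq .
  qed
  \<comment> \<open>For s = 1 and s = -1 the tilting factor is exp (s l - D^2 / 8), as h has squared
    length D^2 / 4. The smaller of exp l and exp (- l) is
    \<open>exp (- \<bar>l\<bar>)\<close>.\<close>
  have ge: "p (\<lambda>i\<in>{..<d}. - (s * h i) + x i) \<ge> exp (- D\<^sup>2 / 8) * (p x * exp (- \<bar>l x\<bar>))"
    if "s = 1 \<or> s = - 1" for s x
  proof -
    have "exp (- D\<^sup>2 / 8) * (p x * exp (- \<bar>l x\<bar>)) = p x * exp (- D\<^sup>2 / 8 + - \<bar>l x\<bar>)"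
      by (simp only: exp_add mult.left_commute)
    also have "\<dots> \<le> p x * exp (s * l x - D\<^sup>2 / 8)"
      using that p0 by (intro mult_left_mono) auto
    also have "\<dots> = p (\<lambda>i\<in>{..<d}. - (s * h i) + x i)"
      unfolding p_def by (subst gauss_density_translate[OF \<Sigma>]) (use that h in \<open>auto simp: l_def\<close>)
    finally show ?thesis .
  qed
  let ?r = "\<lambda>x. ennreal (exp (- D\<^sup>2 / 8)) * ennreal (p x * exp (- \<bar>l x\<bar>))"
  have "ennreal (exp (- D\<^sup>2 / 8 - D - 1) / 2) = ennreal (exp (- D\<^sup>2 / 8)) * ennreal (exp (- D - 1) / 2)"
    by (simp add: ennreal_mult'[symmetric] exp_add[symmetric])
  also have "\<dots> \<le> ennreal (exp (- D\<^sup>2 / 8)) * (\<integral>\<^sup>+ x. ennreal (p x * exp (- \<bar>l x\<bar>)) \<partial>?N)"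
    unfolding p_def l_def by (intro mult_left_mono gauss_overlap_bound[OF \<Sigma> D h]) simp
  also have "\<dots> = (\<integral>\<^sup>+ x. ?r x \<partial>?N)"
    by (rule nn_integral_cmult[symmetric]) simp
  also have "\<dots> \<le> (\<integral>\<^sup>+ x. ennreal (p (\<lambda>i\<in>{..<d}. - (1 * h i) + x i)) * F (\<lambda>i\<in>{..<d}. m i + x i)
      + ennreal (p (\<lambda>i\<in>{..<d}. - (- 1 * h i) + x i)) * F' (\<lambda>i\<in>{..<d}. m i + x i) \<partial>?N)"
  proof (rule nn_integral_mono)
    fix x assume "x \<in> space ?N"
    let ?y = "\<lambda>i\<in>{..<d}. m i + x i"
    have "?y \<in> space (points d)" by (auto simp: points_def space_PiM)
    have "?r x = ?r x * 1" by simp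
    also have "\<dots> \<le> ?r x * (F ?y + F' ?y)"
      using FF'[OF \<open>?y \<in> _\<close>] by (rule mult_left_mono) simp
    also have "\<dots> = ?r x * F ?y + ?r x * F' ?y" by (simp add: distrib_left)
    also have "\<dots> \<le> ennreal (p (\<lambda>i\<in>{..<d}. - (1 * h i) + x i)) * F ?y
        + ennreal (p (\<lambda>i\<in>{..<d}. - (- 1 * h i) + x i)) * F' ?y"
      using ge[of 1 x] ge[of "- 1" x] p0
      by (intro add_mono mult_right_mono) (auto simp: ennreal_mult[symmetric] intro!: ennreal_leI)
    finally show "?r x \<le> \<dots>" .
  qed
  also have "\<dots> = (\<integral>\<^sup>+ e. F (\<lambda>i\<in>{..<d}. u i + e i) \<partial>gauss_law d \<Sigma>)
      + (\<integral>\<^sup>+ e. F' (\<lambda>i\<in>{..<d}. v i + e i) \<partial>gauss_law d \<Sigma>)"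
  proof -
    have "(\<integral>\<^sup>+ e. F (\<lambda>i\<in>{..<d}. u i + e i) \<partial>gauss_law d \<Sigma>)
        = (\<integral>\<^sup>+ x. ennreal (p (\<lambda>i\<in>{..<d}. - (1 * h i) + x i)) * F (\<lambda>i\<in>{..<d}. m i + x i) \<partial>?N)"
      by (rule recentre) (simp_all add: h_def m_def field_simps)
    moreover have "(\<integral>\<^sup>+ e. F' (\<lambda>i\<in>{..<d}. v i + e i) \<partial>gauss_law d \<Sigma>)
        = (\<integral>\<^sup>+ x. ennreal (p (\<lambda>i\<in>{..<d}. - (- 1 * h i) + x i)) * F' (\<lambda>i\<in>{..<d}. m i + x i) \<partial>?N)"
      by (rule recentre) (simp_all add: h_def m_def field_simps)
    ultimately show ?thesis
      by (simp only:) (rule nn_integral_add; measurable)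
  qed
  finally show ?thesis .
qed

section \<open>Reduction to pairwise testing\<close>

lemma loss_attained:
  obtains \<psi> where "\<psi> permutes {1..k}"
    "loss n k z z' = (1 / real n) * (\<Sum>j = 1..n. of_bool (\<psi> (z j) \<noteq> z' j))"
proof -
  have "finite {\<psi>. \<psi> permutes {1..k}}" by (rule finite_permutations) simp
  moreover have "{\<psi>. \<psi> permutes {1..k}} \<noteq> {}" using permutes_id by blast
  ultimately have "loss n k z z' \<in> (\<lambda>\<psi>. (1 / real n) * (\<Sum>j = 1..n. of_bool (\<psi> (z j) \<noteq> z' j))) ` {\<psi>. \<psi> permutes {1..k}}"
    unfolding loss_def by (intro Min_in) auto
  then show ?thesis using that by auto
qed

lemma loss_le:
  assumes "\<psi> permutes {1..k}"
  shows "loss n k z z' \<le> (1 / real n) * (\<Sum>j = 1..n. of_bool (\<psi> (z j) \<noteq> z' j))"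
  unfolding loss_def using assms by (intro Min_le finite_imageI finite_permutations) auto

lemma loss_nonneg: "0 \<le> loss n k z z'"
  by (rule loss_attained[of k n z z']) (simp add: sum_nonneg)

lemma loss_le_1: "loss n k z z' \<le> 1"
proof (rule loss_attained[of k n z z'])
  fix \<psi> assume "loss n k z z' = (1 / real n) * (\<Sum>j = 1..n. of_bool (\<psi> (z j) \<noteq> z' j))"
  also have "\<dots> \<le> (1 / real n) * (\<Sum>j = 1..n. 1)"
    by (intro mult_left_mono sum_mono) auto
  also have "\<dots> \<le> 1" by simp
  finally show ?thesis .
qed

text \<open>If \<psi> relabels w towards z and \<phi> relabels w towards z', then \<phi> after the
  inverse of \<psi> relabels z towards z', and it errs only where one of the two does.\<close>

lemma loss_triangle: "loss n k z z' \<le> loss n k w z + loss n k w z'"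
proof -
  obtain \<psi> where \<psi>: "\<psi> permutes {1..k}"
      "loss n k w z = (1 / real n) * (\<Sum>j = 1..n. of_bool (\<psi> (w j) \<noteq> z j))"
    by (rule loss_attained)
  obtain \<phi> where \<phi>: "\<phi> permutes {1..k}"
      "loss n k w z' = (1 / real n) * (\<Sum>j = 1..n. of_bool (\<phi> (w j) \<noteq> z' j))"
    by (rule loss_attained)
  have inv: "Hilbert_Choice.inv \<psi> (z j) = w j" if "\<psi> (w j) = z j" for j
    using that permutes_inverses(2)[OF \<psi>(1)] by metis
  have "loss n k z z' \<le> (1 / real n) * (\<Sum>j = 1..n. of_bool ((\<phi> \<circ> Hilbert_Choice.inv \<psi>) (z j) \<noteq> z' j))"
    by (intro loss_le permutes_compose permutes_inv \<psi> \<phi>)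
  also have "\<dots> \<le> (1 / real n) * (\<Sum>j = 1..n. of_bool (\<psi> (w j) \<noteq> z j) + of_bool (\<phi> (w j) \<noteq> z' j))"
    using inv by (intro mult_left_mono sum_mono) auto
  finally show ?thesis unfolding \<psi> \<phi> by (simp add: sum.distrib distrib_left)
qed

text \<open>The labels of the first \<open>t\<close> points are free in \<open>{a, b}\<close>; the known labels of the others prevent
  the permutation in the loss from exchanging the two clusters.\<close>

definition two_label_family :: "nat \<Rightarrow> nat \<Rightarrow> nat \<Rightarrow> nat \<Rightarrow> (nat \<Rightarrow> nat) set" where
  "two_label_family n t a b =
     (\<Pi>\<^sub>E j\<in>{1..n}. if j \<le> t then {a, b} else if j \<le> 2 * t then {a} else {b})"

lemma finite_two_label_family: "finite (two_label_family n t a b)"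
  unfolding two_label_family_def by (intro finite_PiE) auto

lemma two_label_family_nonempty: "two_label_family n t a b \<noteq> {}"
  unfolding two_label_family_def by (auto simp: PiE_eq_empty_iff)

lemma two_label_family_subset_labels:
  assumes "a \<in> {1..k}" "b \<in> {1..k}"
  shows "two_label_family n t a b \<subseteq> labels n k"
  unfolding two_label_family_def labels_def using assms by (intro PiE_mono) auto

text \<open>A permutation fixing a and b leaves the mismatches as they are. One that moves a, or b,
  errs on a whole known block; both blocks have at least t points by \<open>3 * t \<le> n\<close>,
  and there are at most t free mismatches.\<close>

lemma mismatches_le_loss:
  assumes z: "z \<in> two_label_family n t a b" "z' \<in> two_label_family n t a b" and t: "3 * t \<le> n"
  shows "(1 / real n) * (\<Sum>j = 1..t. of_bool (z j \<noteq> z' j)) \<le> loss n k z z'"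
proof (rule loss_attained[of k n z z'])
  fix \<psi> assume \<psi>: "\<psi> permutes {1..k}"
    and eq: "loss n k z z' = (1 / real n) * (\<Sum>j = 1..n. of_bool (\<psi> (z j) \<noteq> z' j))"
  let ?f = "\<lambda>j. of_bool (\<psi> (z j) \<noteq> z' j) :: real"
  have free: "z j \<in> {a, b}" if "j \<in> {1..t}" for j
    using PiE_mem[OF z(1)[unfolded two_label_family_def], of j] that t by auto
  have known_a: "z j = a" "z' j = a" if "j \<in> {t<..2 * t}" for j
    using PiE_mem[OF z(1)[unfolded two_label_family_def], of j]
      PiE_mem[OF z(2)[unfolded two_label_family_def], of j] that t by auto
  have known_b: "z j = b" "z' j = b" if "j \<in> {2 * t<..n}" for j
    using PiE_mem[OF z(1)[unfolded two_label_family_def], of j]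
      PiE_mem[OF z(2)[unfolded two_label_family_def], of j] that by auto
  have sub: "sum ?f J \<le> sum ?f {1..n}" if "J \<subseteq> {1..n}" for J
    using that by (intro sum_mono2) auto
  have le_t: "(\<Sum>j = 1..t. of_bool (z j \<noteq> z' j)) \<le> real t"
    using sum_bounded_above[of "{1..t}" "\<lambda>j. of_bool (z j \<noteq> z' j)" "1 :: real"] by simp
  have "(\<Sum>j = 1..t. of_bool (z j \<noteq> z' j)) \<le> sum ?f {1..n}"
  proof -
    consider "\<psi> a = a" "\<psi> b = b" | "\<psi> a \<noteq> a" | "\<psi> b \<noteq> b" by blast
    then show ?thesis
    proof cases
      case 1
      have "(\<Sum>j = 1..t. of_bool (z j \<noteq> z' j)) = sum ?f {1..t}"
        using free 1 by (intro sum.cong) fastforce+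
      also have "\<dots> \<le> sum ?f {1..n}" using t by (intro sub) auto
      finally show ?thesis .
    next
      case 2
      have "sum ?f {t<..2 * t} = (\<Sum>j\<in>{t<..2 * t}. 1)"
        using known_a 2 by (intro sum.cong) auto
      moreover have "{t<..2 * t} \<subseteq> {1..n}" using t by auto
      ultimately show ?thesis using le_t sub[of "{t<..2 * t}"] by simp
    next
      case 3
      have "sum ?f {2 * t<..n} = (\<Sum>j\<in>{2 * t<..n}. 1)"
        using known_b 3 by (intro sum.cong) auto
      moreover have "{2 * t<..n} \<subseteq> {1..n}" by auto
      ultimately show ?thesis using le_t sub[of "{2 * t<..n}"] t by simp
    qed
  qed
  then show ?thesis unfolding eq by (intro mult_left_mono) auto
qed

text \<open>Projecting an estimate onto the nearest member of the family at most doubles its loss, and on the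
  family the loss dominates the number of mismatches.\<close>

lemma project_on_family:
  assumes t: "3 * t \<le> n"
  obtains G :: "(nat \<Rightarrow> nat) \<Rightarrow> nat \<Rightarrow> nat" where
    "\<And>w z. z \<in> two_label_family n t a b \<Longrightarrow>
      (1 / (2 * real n)) * (\<Sum>j = 1..t. of_bool (G w j \<noteq> z j)) \<le> loss n k w z"
proof -
  let ?Z = "two_label_family n t a b"
  have "\<exists>y\<in>?Z. \<forall>z\<in>?Z. loss n k w y \<le> loss n k w z" for w
    using ex_is_arg_min_if_finite[OF finite_two_label_family two_label_family_nonempty, of "loss n k w"]
    unfolding is_arg_min_linorder by blast
  then obtain G where G: "\<And>w. G w \<in> ?Z" "\<And>w z. z \<in> ?Z \<Longrightarrow> loss n k w (G w) \<le> loss n k w z"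
    by metis
  have "(1 / (2 * real n)) * (\<Sum>j = 1..t. of_bool (G w j \<noteq> z j)) \<le> loss n k w z" if z: "z \<in> ?Z" for w z
  proof -
    have "(1 / real n) * (\<Sum>j = 1..t. of_bool (G w j \<noteq> z j)) \<le> loss n k (G w) z"
      by (rule mismatches_le_loss[OF G(1) z t])
    also have "\<dots> \<le> loss n k w (G w) + loss n k w z" by (rule loss_triangle)
    also have "\<dots> \<le> 2 * loss n k w z" using G(2)[OF z, of w] by simp
    finally show ?thesis by simp
  qed
  then show ?thesis using that by blast
qed

section \<open>Testing one label within the joint sample\<close>

lemma prob_space_noise_law:
  assumes "pos_def_mat d \<Sigma>"
  shows "prob_space (noise_law n d \<Sigma>)"
  unfolding noise_law_def using prob_space_gauss_law[OF assms] by (intro prob_space_PiM)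

lemma observation_measurable:
  "observation n d \<theta> z \<in> measurable (noise_law n d \<Sigma>) (\<Pi>\<^sub>M j\<in>{1..n}. points d)"
proof -
  have "(\<lambda>\<epsilon>. \<theta> (z j) $ i + \<epsilon> j i) \<in> borel_measurable (noise_law n d \<Sigma>)" if "j \<in> {1..n}" "i \<in> {..<d}" for i j
  proof -
    have "(\<lambda>\<epsilon>. \<epsilon> j) \<in> measurable (noise_law n d \<Sigma>) (points d)"
      using measurable_component_singleton[OF that(1), of "\<lambda>_. gauss_law d \<Sigma>"]
        measurable_cong_sets[OF refl sets_gauss_law] unfolding noise_law_def by blast
    moreover have "(\<lambda>x. x i) \<in> measurable (points d) borel"
      unfolding points_def by (rule measurable_component_singleton[OF that(2)])
    ultimately have "(\<lambda>\<epsilon>. \<epsilon> j i) \<in> borel_measurable (noise_law n d \<Sigma>)"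
      by (rule measurable_compose)
    then show ?thesis by simp
  qed
  then show ?thesis
    unfolding observation_def points_def by (intro measurable_restrict)
qed

text \<open>Changing the label and the error of point j affects only the j-th observation, so with
  the other errors frozen the sample is a function of that observation alone.\<close>

lemma observation_fun_upd:
  assumes j: "j \<in> {1..n}" and eq: "\<And>l. l \<noteq> j \<Longrightarrow> y l = z l"
  shows "observation n d \<theta> y (x(j := e)) = (observation n d \<theta> z x)(j := (\<lambda>i\<in>{..<d}. \<theta> (y j) $ i + e i))"
proof (rule ext)
  fix l
  show "observation n d \<theta> y (x(j := e)) l
    = ((observation n d \<theta> z x)(j := (\<lambda>i\<in>{..<d}. \<theta> (y j) $ i + e i))) l"
  proof (cases "l = j")
    case True
    then show ?thesis unfolding observation_def using j by (simp only: restrict_apply' fun_upd_same)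
  next
    case False
    show ?thesis
      unfolding observation_def restrict_apply fun_upd_other[OF False] eq[OF False] by (rule refl)
  qed
qed

lemma noise_two_point_bound:
  assumes \<Sigma>: "pos_def_mat d \<Sigma>" and D: "0 \<le> D" and j: "j \<in> {1..n}"
    and z': "\<And>l. l \<noteq> j \<Longrightarrow> z' l = z l"
    and carr: "\<theta> (z j) \<in> carrier_vec d" "\<theta> (z' j) \<in> carrier_vec d"
    and dist: "(\<theta> (z j) - \<theta> (z' j)) \<bullet> (inv_mat \<Sigma> *\<^sub>v (\<theta> (z j) - \<theta> (z' j))) = D\<^sup>2"
    and F: "F \<in> borel_measurable (\<Pi>\<^sub>M j\<in>{1..n}. points d)"
    and F': "F' \<in> borel_measurable (\<Pi>\<^sub>M j\<in>{1..n}. points d)"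
    and FF': "\<And>Y. 1 \<le> F Y + F' Y"
  shows "ennreal (exp (- D\<^sup>2 / 8 - D - 1) / 2)
    \<le> (\<integral>\<^sup>+ \<epsilon>. F (observation n d \<theta> z \<epsilon>) \<partial>noise_law n d \<Sigma>)
      + (\<integral>\<^sup>+ \<epsilon>. F' (observation n d \<theta> z' \<epsilon>) \<partial>noise_law n d \<Sigma>)"
proof -
  let ?g = "gauss_law d \<Sigma>" and ?obs = "observation n d \<theta>" and ?\<beta> = "ennreal (exp (- D\<^sup>2 / 8 - D - 1) / 2)"
  define J where "J = {1..n} - {j}"
  have J: "{1..n} = insert j J" "finite J" "j \<notin> J" using j by (auto simp: J_def)
  interpret g: prob_space ?g by (rule prob_space_gauss_law[OF \<Sigma>])
  interpret product_sigma_finite "\<lambda>_ :: nat. ?g" by standard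
  interpret PJ: prob_space "\<Pi>\<^sub>M l\<in>J. ?g" by (rule prob_space_PiM) (rule prob_space_gauss_law[OF \<Sigma>])
  have meas: "(\<lambda>\<epsilon>. F (?obs z \<epsilon>)) \<in> borel_measurable (noise_law n d \<Sigma>)"
    "(\<lambda>\<epsilon>. F' (?obs z' \<epsilon>)) \<in> borel_measurable (noise_law n d \<Sigma>)"
    by (rule measurable_compose[OF observation_measurable], rule F F')+
  have inner: "?\<beta> \<le> (\<integral>\<^sup>+ e. F (?obs z (x(j := e))) + F' (?obs z' (x(j := e))) \<partial>?g)" for x
  proof -
    have obs_in: "?obs z x l \<in> space (points d)" if "l \<in> {1..n}" for l
      unfolding observation_def restrict_apply'[OF that] points_def by (simp add: space_PiM PiE_iff)
    define Y where "Y = (\<lambda>s. (?obs z x)(j := s))"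
    \<comment> \<open>\<open>measurable_fun_upd\<close> extends a point of the product over
      \<open>J\<close>, hence the restriction; the entry it discards at j is overwritten by the
      update.\<close>
    have "(\<lambda>s. (restrict (?obs z x) J)(j := s)) \<in> measurable (points d) (\<Pi>\<^sub>M j\<in>{1..n}. points d)"
    proof (rule measurable_fun_upd[of _ J j])
      have "restrict (?obs z x) J \<in> space (\<Pi>\<^sub>M l\<in>J. points d)"
        unfolding space_PiM restrict_PiE_iff using obs_in J_def by blast
      then show "(\<lambda>_. restrict (?obs z x) J) \<in> measurable (points d) (\<Pi>\<^sub>M l\<in>J. points d)" by simp
    qed (use J in auto)
    moreover have "(restrict (?obs z x) J)(j := s) = (?obs z x)(j := s)" for s
    proof (rule ext)
      fix l
      have "?obs z x l = undefined" if "l \<notin> {1..n}"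
        unfolding observation_def restrict_apply using that by (rule if_not_P)
      then show "((restrict (?obs z x) J)(j := s)) l = ((?obs z x)(j := s)) l"
        unfolding fun_upd_apply restrict_apply J_def by (metis DiffI singletonD)
    qed
    ultimately have Y: "Y \<in> measurable (points d) (\<Pi>\<^sub>M j\<in>{1..n}. points d)"
      by (simp only: Y_def)
    have upd: "?obs z (x(j := e)) = Y (\<lambda>i\<in>{..<d}. \<theta> (z j) $ i + e i)"
      "?obs z' (x(j := e)) = Y (\<lambda>i\<in>{..<d}. \<theta> (z' j) $ i + e i)" for e
      unfolding Y_def by (rule observation_fun_upd[OF j], use z' in blast)+
    have shift: "(\<lambda>e. \<lambda>i\<in>{..<d}. u i + e i) \<in> measurable ?g (points d)" for u :: "nat \<Rightarrow> real"
    proof -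
      have "(\<lambda>e. \<lambda>i\<in>{..<d}. u i + e i) \<in> measurable (points d) (points d)"
        unfolding points_def
        by (intro measurable_restrict borel_measurable_add borel_measurable_const measurable_component_singleton) auto
      then show ?thesis using measurable_cong_sets[OF sets_gauss_law refl] by blast
    qed
    have "?\<beta> \<le> (\<integral>\<^sup>+ e. F (Y (\<lambda>i\<in>{..<d}. \<theta> (z j) $ i + e i)) \<partial>?g)
        + (\<integral>\<^sup>+ e. F' (Y (\<lambda>i\<in>{..<d}. \<theta> (z' j) $ i + e i)) \<partial>?g)"
    proof (rule gauss_two_point_bound[OF \<Sigma> D])
      have "Matrix.vec d (\<lambda>i. \<theta> (z j) $ i - \<theta> (z' j) $ i) = \<theta> (z j) - \<theta> (z' j)"
        using carr by auto
      then show "Matrix.vec d (\<lambda>i. \<theta> (z j) $ i - \<theta> (z' j) $ i) \<bullet>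
          (inv_mat \<Sigma> *\<^sub>v Matrix.vec d (\<lambda>i. \<theta> (z j) $ i - \<theta> (z' j) $ i)) = D\<^sup>2"
        using dist by simp
    qed (use FF' in \<open>auto intro: measurable_compose[OF Y] F F'\<close>)
    also have "\<dots> = (\<integral>\<^sup>+ e. F (Y (\<lambda>i\<in>{..<d}. \<theta> (z j) $ i + e i)) + F' (Y (\<lambda>i\<in>{..<d}. \<theta> (z' j) $ i + e i)) \<partial>?g)"
      by (intro nn_integral_add[symmetric] measurable_compose[OF measurable_compose[OF shift Y]] F F')
    finally show ?thesis unfolding upd .
  qed
  have "?\<beta> = (\<integral>\<^sup>+ x. ?\<beta> \<partial>(\<Pi>\<^sub>M l\<in>J. ?g))"
    by (simp add: PJ.emeasure_space_1)
  also have "\<dots> \<le> (\<integral>\<^sup>+ x. (\<integral>\<^sup>+ e. F (?obs z (x(j := e))) + F' (?obs z' (x(j := e))) \<partial>?g) \<partial>(\<Pi>\<^sub>M l\<in>J. ?g))"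
    by (intro nn_integral_mono inner)
  also have "\<dots> = (\<integral>\<^sup>+ \<epsilon>. F (?obs z \<epsilon>) + F' (?obs z' \<epsilon>) \<partial>noise_law n d \<Sigma>)"
    unfolding noise_law_def J(1) using meas J
    by (intro product_nn_integral_insert[symmetric] borel_measurable_add) (auto simp: noise_law_def)
  also have "\<dots> = (\<integral>\<^sup>+ \<epsilon>. F (?obs z \<epsilon>) \<partial>noise_law n d \<Sigma>) + (\<integral>\<^sup>+ \<epsilon>. F' (?obs z' \<epsilon>) \<partial>noise_law n d \<Sigma>)"
    by (rule nn_integral_add[OF meas])
  finally show ?thesis .
qed

section \<open>From pairwise errors to the minimax risk\<close>

lemma minimax_risk_lower_bound:
  assumes \<Sigma>: "pos_def_mat d \<Sigma>" and D: "0 \<le> D"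
    and ab: "a \<in> {1..k}" "b \<in> {1..k}" "a \<noteq> b"
    and carr: "\<theta> a \<in> carrier_vec d" "\<theta> b \<in> carrier_vec d"
    and dist: "(\<theta> a - \<theta> b) \<bullet> (inv_mat \<Sigma> *\<^sub>v (\<theta> a - \<theta> b)) = D\<^sup>2"
    and n: "3 \<le> n"
  shows "exp (- D\<^sup>2 / 8 - D - 1) / 40 \<le> minimax_risk n k d \<theta> \<Sigma>"
  unfolding minimax_risk_def
proof (rule cINF_greatest)
  \<comment> \<open>A constant estimator shows that the infimum is over a nonempty set, as the rule
    for real infima demands.\<close>
  have "(\<lambda>j\<in>{1..n}. a) \<in> labels n k" using ab by (auto simp: labels_def)
  then have "(\<lambda>_. \<lambda>j\<in>{1..n}. a) \<in> estimators n k d" by (simp add: estimators_def)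
  then show "estimators n k d \<noteq> {}" by blast
next
  fix zhat assume zhat: "zhat \<in> estimators n k d"
  define t where "t = n div 3"
  \<comment> \<open>The ratio n / t is largest at n = 5, where t = 1; this fixes the constant
    5.\<close>
  have t: "3 * t \<le> n" "n \<le> 5 * t" using n unfolding t_def by presburger+
  define \<beta> where "\<beta> = exp (- D\<^sup>2 / 8 - D - 1) / 2"
  let ?M = "noise_law n d \<Sigma>" and ?Z = "two_label_family n t a b"
  interpret M: prob_space ?M by (rule prob_space_noise_law[OF \<Sigma>])
  obtain G :: "(nat \<Rightarrow> nat) \<Rightarrow> nat \<Rightarrow> nat" where G: "\<And>w z. z \<in> ?Z \<Longrightarrow>
      (1 / (2 * real n)) * (\<Sum>j = 1..t. of_bool (G w j \<noteq> z j)) \<le> loss n k w z"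
    using project_on_family[OF t(1)] by blast
  define W where "W = (\<lambda>z \<epsilon>. zhat (observation n d \<theta> z \<epsilon>))"
  \<comment> \<open>Estimates take values in a \<open>count_space\<close>, so every function of
    them, in particular the projection G, is measurable. The target type is left open because both
    real and extended nonnegative integrands occur.\<close>
  have zhat_meas: "(\<lambda>Y. f (zhat Y)) \<in> borel_measurable (\<Pi>\<^sub>M j\<in>{1..n}. points d)"
    for f :: "(nat \<Rightarrow> nat) \<Rightarrow> 'b :: topological_space"
    by (rule measurable_compose[OF zhat[unfolded estimators_def]]) simp
  have W_meas: "(\<lambda>\<epsilon>. f (W z \<epsilon>)) \<in> borel_measurable ?M" for f :: "(nat \<Rightarrow> nat) \<Rightarrow> 'b :: topological_space" and z
    unfolding W_def by (rule measurable_compose[OF observation_measurable zhat_meas])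
  define r where "r = (\<lambda>j z. \<integral>\<epsilon>. of_bool (G (W z \<epsilon>) j \<noteq> z j) \<partial>?M :: real)"
  have int_r: "integrable ?M (\<lambda>\<epsilon>. of_bool (G (W z \<epsilon>) j \<noteq> z j) :: real)" for j z
    by (rule M.integrable_const_bound[of _ 1]) (auto intro: W_meas)
  have r_enn: "ennreal (r j z) = (\<integral>\<^sup>+ \<epsilon>. of_bool (G (W z \<epsilon>) j \<noteq> z j) \<partial>?M)" for j z
  proof -
    have "ennreal (r j z) = (\<integral>\<^sup>+ \<epsilon>. ennreal (of_bool (G (W z \<epsilon>) j \<noteq> z j)) \<partial>?M)"
      unfolding r_def by (rule nn_integral_eq_integral[OF int_r, symmetric]) simp
    also have "\<dots> = (\<integral>\<^sup>+ \<epsilon>. of_bool (G (W z \<epsilon>) j \<noteq> z j) \<partial>?M)"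
      by (intro nn_integral_cong) (simp add: of_bool_def)
    finally show ?thesis .
  qed
  have r0: "0 \<le> r j z" for j z unfolding r_def by simp
  have risk: "(1 / (2 * real n)) * (\<Sum>j = 1..t. r j z) \<le> risk n k d \<theta> \<Sigma> zhat z" if "z \<in> ?Z" for z
  proof -
    have "(1 / (2 * real n)) * (\<Sum>j = 1..t. r j z)
        = (\<integral>\<epsilon>. (1 / (2 * real n)) * (\<Sum>j = 1..t. of_bool (G (W z \<epsilon>) j \<noteq> z j)) \<partial>?M)"
      unfolding r_def by (subst integral_mult_right_zero, subst Bochner_Integration.integral_sum) (rule int_r, rule refl)
    also have "\<dots> \<le> (\<integral>\<epsilon>. loss n k (W z \<epsilon>) z \<partial>?M)"
    proof (rule integral_mono)
      show "integrable ?M (\<lambda>\<epsilon>. (1 / (2 * real n)) * (\<Sum>j = 1..t. of_bool (G (W z \<epsilon>) j \<noteq> z j)))"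
        by (intro integrable_mult_right Bochner_Integration.integrable_sum int_r)
      show "integrable ?M (\<lambda>\<epsilon>. loss n k (W z \<epsilon>) z)"
        by (rule M.integrable_const_bound[of _ 1]) (auto intro: W_meas simp: loss_nonneg loss_le_1)
    qed (rule G[OF that])
    finally show ?thesis unfolding risk_def W_def .
  qed
  have two_point: "\<beta> \<le> r j z + r j z'"
    if "j \<in> {1..n}" "\<And>l. l \<noteq> j \<Longrightarrow> z' l = z l" "z j = a" "z' j = b" for j z z'
  proof -
    have "ennreal \<beta> \<le> (\<integral>\<^sup>+ \<epsilon>. of_bool (G (zhat (observation n d \<theta> z \<epsilon>)) j \<noteq> a) \<partial>?M)
        + (\<integral>\<^sup>+ \<epsilon>. of_bool (G (zhat (observation n d \<theta> z' \<epsilon>)) j \<noteq> b) \<partial>?M)"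
      unfolding \<beta>_def
    proof (rule noise_two_point_bound[OF \<Sigma> D that(1,2)])
      show "1 \<le> of_bool (G (zhat Y) j \<noteq> a) + (of_bool (G (zhat Y) j \<noteq> b) :: ennreal)" for Y
        using ab(3) by auto
      show "(\<lambda>Y. of_bool (G (zhat Y) j \<noteq> a) :: ennreal) \<in> borel_measurable (\<Pi>\<^sub>M j\<in>{1..n}. points d)"
        "(\<lambda>Y. of_bool (G (zhat Y) j \<noteq> b) :: ennreal) \<in> borel_measurable (\<Pi>\<^sub>M j\<in>{1..n}. points d)"
        by (rule zhat_meas)+
    qed (use that carr dist in simp_all)
    also have "\<dots> = ennreal (r j z + r j z')"
      unfolding r_enn W_def ennreal_plus[OF r0 r0] that(3,4) by (rule refl)
    finally show ?thesis
      by (subst (asm) ennreal_le_iff) (simp_all add: r0 add_nonneg_nonneg)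
  qed
  define flip where "flip = (\<lambda>j z. z(j := if z j = a then b else a) :: nat \<Rightarrow> nat)"
  have free: "z j = a \<or> z j = b" if "z \<in> ?Z" "j \<in> {1..t}" for j z
    using PiE_mem[OF that(1)[unfolded two_label_family_def], of j] that(2) t by auto
  have flip_mem: "flip j z \<in> ?Z" if "z \<in> ?Z" "j \<in> {1..t}" for j z
  proof -
    have "flip j z \<in> (\<Pi>\<^sub>E l\<in>insert j {1..n}. if l \<le> t then {a, b} else if l \<le> 2 * t then {a} else {b})"
      unfolding flip_def using that by (intro PiE_fun_upd) (auto simp: two_label_family_def)
    moreover have "insert j {1..n} = {1..n}" using that t by auto
    ultimately show ?thesis by (simp only: two_label_family_def)
  qed
  have flip_flip: "flip j (flip j z) = z" if "z \<in> ?Z" "j \<in> {1..t}" for j z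
    using free[OF that] ab(3) by (auto simp: flip_def)
  \<comment> \<open>Flipping label j is an involution of the family, so adding the errors at z and
    at its flip over all z counts each error twice: on average \<open>\<beta> / 2\<close> per label
    vector.\<close>
  have sum_r: "real (card ?Z) * (\<beta> / 2) \<le> (\<Sum>z\<in>?Z. r j z)" if j: "j \<in> {1..t}" for j
  proof -
    have jn: "j \<in> {1..n}" using j t by auto
    have "bij_betw (flip j) ?Z ?Z"
      by (rule bij_betwI[where g = "flip j"]) (auto intro: flip_mem flip_flip j)
    then have eq: "(\<Sum>z\<in>?Z. r j (flip j z)) = (\<Sum>z\<in>?Z. r j z)"
      by (rule sum.reindex_bij_betw)
    have "\<beta> \<le> r j z + r j (flip j z)" if z: "z \<in> ?Z" for z
    proof (cases "z j = a")
      case True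
      then show ?thesis using two_point[OF jn, of "flip j z" z] by (simp add: flip_def)
    next
      case False
      then show ?thesis
        using two_point[OF jn, of z "flip j z"] free[OF z j] by (simp add: flip_def add.commute)
    qed
    then have "(\<Sum>z\<in>?Z. \<beta>) \<le> (\<Sum>z\<in>?Z. r j z + r j (flip j z))" by (rule sum_mono)
    then show ?thesis by (simp add: sum.distrib eq)
  qed
  define s where "s = (SUP z\<in>labels n k. risk n k d \<theta> \<Sigma> zhat z)"
  \<comment> \<open>A supremum of reals bounds its members only if the set is bounded above; here
    finiteness of the label set ensures it.\<close>
  have bdd: "bdd_above (risk n k d \<theta> \<Sigma> zhat ` labels n k)"
    by (intro bdd_above_finite finite_imageI) (simp add: labels_def finite_PiE)
  have le_s: "risk n k d \<theta> \<Sigma> zhat z \<le> s" if "z \<in> ?Z" for z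
    unfolding s_def using that two_label_family_subset_labels[OF ab(1,2)] bdd by (intro cSUP_upper) auto
  have card: "0 < real (card ?Z)"
    using finite_two_label_family two_label_family_nonempty by (simp add: card_gt_0_iff)
  \<comment> \<open>The supremum dominates the average over the family; the inequality is kept
    multiplied by the cardinality until the end.\<close>
  have "real (card ?Z) * (real t * \<beta> / (4 * real n)) = (1 / (2 * real n)) * (\<Sum>j = 1..t. real (card ?Z) * (\<beta> / 2))"
    by simp
  also have "\<dots> \<le> (1 / (2 * real n)) * (\<Sum>j = 1..t. \<Sum>z\<in>?Z. r j z)"
    by (intro mult_left_mono sum_mono sum_r) auto
  also have "\<dots> = (\<Sum>z\<in>?Z. (1 / (2 * real n)) * (\<Sum>j = 1..t. r j z))"
    by (subst sum.swap) (simp add: sum_distrib_left)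
  also have "\<dots> \<le> (\<Sum>z\<in>?Z. s)"
    using risk le_s by (intro sum_mono) (meson order_trans)
  finally have "real (card ?Z) * (real t * \<beta> / (4 * real n)) \<le> real (card ?Z) * s"
    by (simp only: sum_constant)
  then have "real t * \<beta> / (4 * real n) \<le> s"
    by (simp only: mult_le_cancel_left_pos[OF card])
  moreover have "\<beta> / 20 \<le> real t * \<beta> / (4 * real n)"
  proof -
    have "real n * \<beta> \<le> real (5 * t) * \<beta>"
      using t by (intro mult_right_mono) (auto simp: \<beta>_def)
    then show ?thesis using n by (simp add: field_simps)
  qed
  ultimately have "\<beta> / 20 \<le> s" by linarith
  then show "exp (- D\<^sup>2 / 8 - D - 1) / 40 \<le> (SUP z\<in>labels n k. risk n k d \<theta> \<Sigma> zhat z)"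
    by (simp add: s_def \<beta>_def)
qed

section \<open>Asymptotics of the finite-sample bound\<close>

theorem theorem2p1:
  fixes k d :: "nat \<Rightarrow> nat"
    and \<theta> :: "nat \<Rightarrow> nat \<Rightarrow> real Matrix.vec"
    and \<Sigma> :: "nat \<Rightarrow> real Matrix.mat"
  assumes "\<And>n. k n \<ge> 2"
    and "\<And>n a. a \<in> {1..k n} \<Longrightarrow> \<theta> n a \<in> carrier_vec (d n)"
    and "\<And>n. pos_def_mat (d n) (\<Sigma> n)"
  shows "(filterlim (\<lambda>n. snr (k n) (\<theta> n) (\<Sigma> n) / sqrt (ln (real (k n)))) at_top sequentially \<longrightarrow>
           (\<exists>\<delta> :: nat \<Rightarrow> real. \<delta> \<longlonglongrightarrow> 0 \<and>
             (\<forall>\<^sub>F n in sequentially.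
                minimax_risk n (k n) (d n) (\<theta> n) (\<Sigma> n)
                  \<ge> exp (- (1 + \<delta> n) * (snr (k n) (\<theta> n) (\<Sigma> n))\<^sup>2 / 8)))) \<and>
         ((\<lambda>n. snr (k n) (\<theta> n) (\<Sigma> n)) \<in> O(\<lambda>n. 1) \<longrightarrow>
           (\<exists>c > 0. \<forall>\<^sub>F n in sequentially.
                minimax_risk n (k n) (d n) (\<theta> n) (\<Sigma> n) \<ge> c))"
proof (intro conjI impI)
  define D where "D = (\<lambda>n. snr (k n) (\<theta> n) (\<Sigma> n))"
  let ?R = "\<lambda>n. minimax_risk n (k n) (d n) (\<theta> n) (\<Sigma> n)"
  have carr: "\<And>a. a \<in> {1..k n} \<Longrightarrow> \<theta> n a \<in> carrier_vec (d n)" for n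
    by (rule assms(2))
  have attained: "\<exists>a b. a \<in> {1..k n} \<and> b \<in> {1..k n} \<and> a \<noteq> b \<and> 0 \<le> D n \<and>
    (\<theta> n a - \<theta> n b) \<bullet> (inv_mat (\<Sigma> n) *\<^sub>v (\<theta> n a - \<theta> n b)) = (D n)\<^sup>2" for n
    using snr_attained[of "k n" "\<theta> n" "d n" "\<Sigma> n", OF assms(1) carr assms(3)]
    unfolding D_def by blast
  then have D0: "0 \<le> D n" for n by blast
  have bound: "exp (- (D n)\<^sup>2 / 8 - D n - 1) / 40 \<le> ?R n" if n: "3 \<le> n" for n
  proof -
    obtain a b where ab: "a \<in> {1..k n}" "b \<in> {1..k n}" "a \<noteq> b"
      "(\<theta> n a - \<theta> n b) \<bullet> (inv_mat (\<Sigma> n) *\<^sub>v (\<theta> n a - \<theta> n b)) = (D n)\<^sup>2"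
      using attained by blast
    show ?thesis
      by (rule minimax_risk_lower_bound[OF assms(3) D0 ab(1-3) carr[OF ab(1)] carr[OF ab(2)] ab(4) n])
  qed
  {
    assume "filterlim (\<lambda>n. snr (k n) (\<theta> n) (\<Sigma> n) / sqrt (ln (real (k n)))) at_top sequentially"
    \<comment> \<open>Since \<open>ln (k n)\<close> is at least \<open>ln 2\<close>, divergence of
      the ratio carries over to \<open>D\<close> itself.\<close>
    then have "filterlim (\<lambda>n. sqrt (ln 2) * (D n / sqrt (ln (real (k n))))) at_top sequentially"
      unfolding D_def by (intro filterlim_tendsto_pos_mult_at_top[OF tendsto_const]) auto
    moreover have "sqrt (ln 2) * (D n / sqrt (ln (real (k n)))) \<le> D n" for n
    proof -
      have "ln 2 \<le> ln (real (k n))" using assms(1)[of n] by (subst ln_le_cancel_iff) auto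
      then have "sqrt (ln 2) * D n \<le> sqrt (ln (real (k n))) * D n"
        by (intro mult_right_mono D0) simp
      moreover have "0 < sqrt (ln (real (k n)))"
        using assms(1)[of n] by simp
      ultimately show ?thesis by (simp add: pos_divide_le_eq mult.commute)
    qed
    ultimately have D_top: "filterlim D at_top sequentially"
      by (auto elim!: filterlim_at_top_mono)
    \<comment> \<open>Solves (1 + \<delta>) D^2 / 8 = D^2 / 8 + D + 1 + ln 40, absorbing the linear
      loss and the factor 1/40. Where \<open>D n = 0\<close> the quotient defaults to 0, but
      eventually \<open>D n > 0\<close>.\<close>
    define \<delta> where "\<delta> = (\<lambda>n. 8 * (D n + 1 + ln 40) / (D n)\<^sup>2)"
    have "((\<lambda>x :: real. 8 * (x + 1 + ln 40) / x\<^sup>2) \<longlongrightarrow> 0) at_top" by real_asymp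
    then have "\<delta> \<longlonglongrightarrow> 0" unfolding \<delta>_def by (rule filterlim_compose[OF _ D_top])
    moreover have "\<forall>\<^sub>F n in sequentially. ?R n \<ge> exp (- (1 + \<delta> n) * (D n)\<^sup>2 / 8)"
      using filterlim_at_top_dense[THEN iffD1, OF D_top, rule_format, of 0] eventually_ge_at_top[of 3]
    proof eventually_elim
      case (elim n)
      have "- (1 + \<delta> n) * (D n)\<^sup>2 / 8 = (- (D n)\<^sup>2 / 8 - D n - 1) - ln 40"
        using elim(1) by (simp add: \<delta>_def field_simps)
      then have "exp (- (1 + \<delta> n) * (D n)\<^sup>2 / 8) = exp (- (D n)\<^sup>2 / 8 - D n - 1) / 40"
        by (simp only: exp_diff[of _ "ln 40"]) simp
      then show ?case using bound[OF elim(2)] by simp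
    qed
    ultimately show "\<exists>\<delta> :: nat \<Rightarrow> real. \<delta> \<longlonglongrightarrow> 0 \<and> (\<forall>\<^sub>F n in sequentially.
        ?R n \<ge> exp (- (1 + \<delta> n) * (snr (k n) (\<theta> n) (\<Sigma> n))\<^sup>2 / 8))"
      unfolding D_def by blast
  }
  {
    assume "(\<lambda>n. snr (k n) (\<theta> n) (\<Sigma> n)) \<in> O(\<lambda>n. 1)"
    then obtain C where C: "\<forall>\<^sub>F n in sequentially. norm (D n) \<le> C * norm (1 :: real)"
      unfolding D_def by (elim landau_o.bigE)
    \<comment> \<open>The finite-sample bound is decreasing in \<open>D n\<close> on the nonnegative
      reals, so an eventual upper bound C on the SNR yields a constant.\<close>
    have "\<forall>\<^sub>F n in sequentially. ?R n \<ge> exp (- C\<^sup>2 / 8 - C - 1) / 40"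
      using C eventually_ge_at_top[of 3]
    proof eventually_elim
      case (elim n)
      then have "D n \<le> C" "(D n)\<^sup>2 \<le> C\<^sup>2" using D0[of n] by (auto intro: power_mono)
      then have "exp (- C\<^sup>2 / 8 - C - 1) / 40 \<le> exp (- (D n)\<^sup>2 / 8 - D n - 1) / 40" by simp
      then show ?case using bound[OF elim(2)] by linarith
    qed
    then show "\<exists>c > 0. \<forall>\<^sub>F n in sequentially. ?R n \<ge> c"
      by (intro exI[of _ "exp (- C\<^sup>2 / 8 - C - 1) / 40"]) simp
  }
qed

end
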